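(* Let $\mathcal{C}=\prod_{m\ge2}\mathcal{C}_m$ be the Lie algebra of oriented chord diagrams, and for $m\ge2$ let $\Omega_m\in\mathcal{C}_m$ be the element given by the closing of the labeled linear chord diagram $\{(1,2),(3,4),\ldots,(2m-1,2m)\}$, i.e. $\Omega_m=N(\{(1,2),(3,4),\ldots,(2m-1,2m)\})$. Then the center of $\mathcal{C}$ is $$Z(\mathcal{C})=\prod_{m\ge2}\mathbb{Q}\,\Omega_m .$$
   Context: A labeled linear chord diagram of $m$ chords ($m\ge1$) is a set $C=\{(i_1,j_1),\ldots,(i_m,j_m)\}$ of $m$ ordered pairs with $\{i_1,\ldots,i_m,j_1,\ldots,j_m\}=\{1,\ldots,2m\}$. $\mathcal{LC}_m$ is the $\mathbb{Q}$-vector space spanned by the labeled linear chord diagrams of $m$ chords modulo the subspace generated by all $C+C'$ where $C'$ is obtained from $C$ by a single label change (replacing one pair $(i_k,j_k)$ by $(j_k,i_k)$). Let $\nu\in\mathfrak S_{2m}$ be the cyclic permutation $\nu(1)=2m$, $\nu(k)=k-1$ for $2\le k\le 2m$, acting on labeled linear chord diagrams by $\nu^s(C)=\{(\nu^s(i_k),\nu^s(j_k))\}_k$; this induces an action of the cyclic group $Z_{2m}=\langle\nu\rangle$ on $\mathcal{LC}_m$. Put $\mathcal{C}_m:=(\mathcal{LC}_m)^{Z_{2m}}$ and $N(C):=\sum_{s=0}^{2m-1}\nu^s(C)\in\mathcal{C}_m$; the elements $N(C)$ span $\mathcal C_m$. One has $\mathcal{C}_1=0$, and $\mathcal{C}:=\prod_{m\ge2}\mathcal{C}_m$.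 Amalgamation: for labeled linear chord diagrams $C=\{(i_1,j_1),\ldots,(i_m,j_m)\}$ and $C'=\{(a_1,b_1),\ldots,(a_l,b_l)\}$, ordered so that $1\in\{i_1,j_1\}\cap\{a_1,b_1\}$, $C\ast C'$ is the labeled linear chord diagram of $m+l-1$ chords $$\{(x,y),(i_2-1,j_2-1),\ldots,(i_m-1,j_m-1),(a_2+2m-2,b_2+2m-2),\ldots,(a_l+2m-2,b_l+2m-2)\},$$ where $(x,y)=(b_1+2m-2,j_1-1)$ if $i_1=a_1=1$; $(j_1-1,a_1+2m-2)$ if $i_1=b_1=1$; $(i_1-1,b_1+2m-2)$ if $j_1=a_1=1$; $(a_1+2m-2,i_1-1)$ if $j_1=b_1=1$. The Lie bracket on $\mathcal{C}$ is the one determined by $$[N(C),N(C')]=\sum_{s=0}^{2m-1}\sum_{t=0}^{2l-1}N\big((\nu^sC)\ast(\nu^tC')\big)\in\mathcal{C}_{m+l-1}$$ (extended to the product degreewise); $\mathcal{C}$ with this bracket is called the Lie algebra of oriented chord diagrams. *)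

theory Defs
  imports Complex_Main "HOL-Library.Poly_Mapping"
begin

section \<open>Labeled linear chord diagrams\<close>

definition is_lcd :: "nat \<Rightarrow> (nat \<times> nat) set \<Rightarrow> bool" where
  "is_lcd m C \<longleftrightarrow> finite C \<and> card C = m \<and> fst ` C \<union> snd ` C = {1..2*m}"

typedef lcd = "{C. \<exists>m\<ge>1. is_lcd m C}"
  morphisms chords Abs_lcd
  by (rule exI[of _ "{(1,2)}"]) (auto simp: is_lcd_def intro!: exI[of _ 1])

setup_lifting type_definition_lcd

definition nchords :: "lcd \<Rightarrow> nat" where
  "nchords C = card (chords C)"

definition label_change :: "lcd \<Rightarrow> lcd \<Rightarrow> bool" where
  "label_change C D \<longleftrightarrow>
     (\<exists>i j. (i, j) \<in> chords C \<and> chords D = insert (j, i) (chords C - {(i, j)}))"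

lemma card_ends_le:
  assumes "finite C"
  shows "card (fst ` C \<union> snd ` C) \<le> 2 * card C"
  using card_Un_le[of "fst ` C" "snd ` C"] card_image_le[OF assms, of fst]
    card_image_le[OF assms, of snd] by linarith

lemma is_lcd_unique:
  assumes C: "is_lcd m C" and c: "c \<in> C" and d: "d \<in> C"
    and x: "x = fst c \<or> x = snd c" and y: "x = fst d \<or> x = snd d"
  shows "c = d"
proof (rule ccontr)
  assume ne: "c \<noteq> d"
  have fin: "finite C" and card: "card C = m" and un: "fst ` C \<union> snd ` C = {1..2*m}"
    using C by (auto simp: is_lcd_def)
  obtain z where z: "{fst c, snd c} = {x, z}" using x by auto
  have "x \<in> fst ` (C - {c}) \<union> snd ` (C - {c})" using y d ne by auto
  moreover have "fst ` C \<union> snd ` C = {fst c, snd c} \<union> (fst ` (C - {c}) \<union> snd ` (C - {c}))"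
    using c by auto
  ultimately have "{1..2*m} = insert z (fst ` (C - {c}) \<union> snd ` (C - {c}))"
    using un z by auto
  hence "2 * m = card (insert z (fst ` (C - {c}) \<union> snd ` (C - {c})))"
    by (metis card_atLeastAtMost diff_Suc_1 add.commute plus_1_eq_Suc)
  also have "\<dots> \<le> Suc (card (fst ` (C - {c}) \<union> snd ` (C - {c})))"
    by (rule card_insert_le_m1) (auto simp: fin)
  also have "\<dots> \<le> Suc (2 * card (C - {c}))" using card_ends_le[of "C - {c}"] fin by simp
  also have "\<dots> = Suc (2 * (m - 1))" using card c fin by simp
  finally show False using card c fin by (cases m) auto
qed

lemma is_lcd_neq:
  assumes C: "is_lcd m C" and c: "c \<in> C"
  shows "fst c \<noteq> snd c"
proof
  assume eq: "fst c = snd c"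
  have fin: "finite C" and card: "card C = m" and un: "fst ` C \<union> snd ` C = {1..2*m}"
    using C by (auto simp: is_lcd_def)
  have "{1..2*m} = insert (fst c) (fst ` (C - {c}) \<union> snd ` (C - {c}))"
    using un c eq by auto
  hence "2 * m = card (insert (fst c) (fst ` (C - {c}) \<union> snd ` (C - {c})))"
    by (metis card_atLeastAtMost diff_Suc_1 add.commute plus_1_eq_Suc)
  also have "\<dots> \<le> Suc (card (fst ` (C - {c}) \<union> snd ` (C - {c})))"
    by (rule card_insert_le_m1) (auto simp: fin)
  also have "\<dots> \<le> Suc (2 * card (C - {c}))" using card_ends_le[of "C - {c}"] fin by simp
  also have "\<dots> = Suc (2 * (m - 1))" using card c fin by simp
  finally show False using card c fin by (cases m) auto
qed

lemma is_lcd_I: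
  assumes "finite C" "card C \<le> m" "fst ` C \<union> snd ` C = {1..2*m}"
  shows "is_lcd m C"
proof -
  have "2 * m \<le> 2 * card C" using card_ends_le[OF assms(1)] assms(3) by simp
  thus ?thesis using assms by (simp add: is_lcd_def)
qed

lemma is_lcd_chords: "is_lcd (nchords C) (chords C)"
  and nchords_ge_1: "nchords C \<ge> 1"
  using chords[of C] by (auto simp: nchords_def is_lcd_def)

lemma nchords_eqI: "is_lcd m (chords C) \<Longrightarrow> nchords C = m"
  by (simp add: nchords_def is_lcd_def)

lemma label_changeI:
  assumes C: "chords C = insert (i, j) R" and D: "chords D = insert (j, i) R"
  shows "label_change C D"
proof -
  have ij: "i \<noteq> j" using is_lcd_neq[OF is_lcd_chords, of "(i,j)" C] C by simp
  have "(i, j) \<notin> R"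
  proof
    assume "(i, j) \<in> R"
    hence "(i, j) = (j, i)"
      by (intro is_lcd_unique[OF is_lcd_chords, of "(i,j)" D "(j,i)" i]) (simp_all add: D)
    hence "fst (i, j) = fst (j, i)" by (rule arg_cong)
    thus False using ij by simp
  qed
  hence "chords C - {(i, j)} = R" unfolding C by (rule Diff_insert_absorb)
  hence "chords D = insert (j, i) (chords C - {(i, j)})" using D by (simp only:)
  thus ?thesis unfolding label_change_def using C by (intro exI[of _ i] exI[of _ j]) simp
qed

lemma label_changeE:
  assumes "label_change C D"
  obtains i j R where "chords C = insert (i, j) R" "(i, j) \<notin> R" "chords D = insert (j, i) R"
proof -
  obtain i j where ij: "(i, j) \<in> chords C" "chords D = insert (j, i) (chords C - {(i, j)})"
    using assms unfolding label_change_def by blast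
  show ?thesis using that[of i j "chords C - {(i, j)}"] ij by (simp add: insert_absorb)
qed

lemma nchords_label_change:
  assumes "label_change C D"
  shows "nchords C = nchords D"
proof -
  obtain i j R where R: "chords C = insert (i, j) R" "chords D = insert (j, i) R"
    using assms by (rule label_changeE)
  have "fst ` chords C \<union> snd ` chords C = fst ` chords D \<union> snd ` chords D" using R by auto
  hence "{1..2 * nchords C} = {1..2 * nchords D}" using is_lcd_chords by (simp add: is_lcd_def)
  hence "card {1..2 * nchords C} = card {1..2 * nchords D}" by (rule arg_cong)
  thus ?thesis by (simp only: card_atLeastAtMost)
qed

subsection \<open>Rotation\<close>

definition nu :: "nat \<Rightarrow> nat \<Rightarrow> nat" where
  "nu m k = (if k = 1 then 2 * m else k - 1)"

lemma nu_image:
  assumes "m \<ge> 1"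
  shows "nu m ` {1..2*m} = {1..2*m}"
proof
  show "nu m ` {1..2*m} \<subseteq> {1..2*m}" using assms by (auto simp: nu_def)
  show "{1..2*m} \<subseteq> nu m ` {1..2*m}"
  proof
    fix k assume k: "k \<in> {1..2*m}"
    show "k \<in> nu m ` {1..2*m}"
    proof (cases "k = 2 * m")
      case True
      thus ?thesis using assms by (intro image_eqI[of _ _ 1]) (auto simp: nu_def)
    next
      case False
      thus ?thesis using k by (intro image_eqI[of _ _ "Suc k"]) (auto simp: nu_def)
    qed
  qed
qed

lemma is_lcd_rotate:
  assumes "is_lcd m C" "m \<ge> 1"
  shows "is_lcd m (map_prod (nu m) (nu m) ` C)"
proof (rule is_lcd_I)
  show "finite (map_prod (nu m) (nu m) ` C)" "card (map_prod (nu m) (nu m) ` C) \<le> m"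
    using assms card_image_le[of C] by (auto simp: is_lcd_def)
  have "fst ` map_prod (nu m) (nu m) ` C \<union> snd ` map_prod (nu m) (nu m) ` C
      = nu m ` (fst ` C \<union> snd ` C)"
    by (auto simp: image_Un image_image)
  thus "fst ` map_prod (nu m) (nu m) ` C \<union> snd ` map_prod (nu m) (nu m) ` C = {1..2*m}"
    using assms nu_image[of m] by (simp add: is_lcd_def)
qed

lift_definition rotate :: "lcd \<Rightarrow> lcd" is
  "\<lambda>C. map_prod (nu (card C)) (nu (card C)) ` C"
  using is_lcd_rotate by (metis (no_types, lifting) is_lcd_def)

lemma chords_rotate: "chords (rotate C) = map_prod (nu (nchords C)) (nu (nchords C)) ` chords C"
  by (simp add: rotate.rep_eq nchords_def)

lemma nchords_rotate [simp]: "nchords (rotate C) = nchords C"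
  using is_lcd_rotate[OF is_lcd_chords nchords_ge_1, of C]
  by (intro nchords_eqI) (simp only: chords_rotate)

lemma nchords_rotate_funpow [simp]: "nchords ((rotate ^^ s) C) = nchords C"
  by (induction s) auto

lemma nu_funpow_le: "1 \<le> k \<Longrightarrow> s < k \<Longrightarrow> (nu m ^^ s) k = k - s"
  by (induction s) (auto simp: nu_def)

lemma nu_funpow_order:
  assumes "k \<in> {1..2*m}"
  shows "(nu m ^^ (2*m)) k = k"
proof -
  have "(nu m ^^ (k - 1)) k = 1" using assms by (subst nu_funpow_le) auto
  hence "(nu m ^^ k) k = 2 * m" using assms by (cases k) (auto simp: nu_def)
  moreover have "(nu m ^^ (2*m - k)) (2 * m) = k"
    using assms by (subst nu_funpow_le) auto
  moreover have "(nu m ^^ (2*m)) k = (nu m ^^ (2*m - k)) ((nu m ^^ k) k)"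
  proof -
    have "2*m = (2*m - k) + k" using assms by auto
    thus ?thesis by (metis funpow_add comp_apply)
  qed
  ultimately show ?thesis by simp
qed

lemma chords_rotate_funpow:
  "chords ((rotate ^^ s) C) = map_prod (nu (nchords C) ^^ s) (nu (nchords C) ^^ s) ` chords C"
proof (induction s)
  case 0
  show ?case by (simp add: map_prod.id[unfolded id_def] id_def)
next
  case (Suc s)
  show ?case by (simp add: chords_rotate Suc image_image map_prod_def case_prod_unfold)
qed

lemma rotate_order: "(rotate ^^ (2 * nchords C)) C = C"
proof -
  let ?m = "nchords C"
  have "map_prod (nu ?m ^^ (2*?m)) (nu ?m ^^ (2*?m)) c = c" if "c \<in> chords C" for c
  proof -
    have "fst c \<in> {1..2*?m}" "snd c \<in> {1..2*?m}"
      using is_lcd_chords[of C] that by (auto simp: is_lcd_def)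
    thus ?thesis by (simp add: map_prod_def case_prod_unfold nu_funpow_order)
  qed
  hence "chords ((rotate ^^ (2 * ?m)) C) = chords C"
    by (simp add: chords_rotate_funpow)
  thus ?thesis by (simp add: chords_inject)
qed

lemma label_change_rotate:
  assumes "label_change C D"
  shows "label_change (rotate C) (rotate D)"
proof -
  obtain i j R where R: "chords C = insert (i, j) R" "(i, j) \<notin> R" "chords D = insert (j, i) R"
    using assms by (rule label_changeE)
  have "nchords C = nchords D" by (rule nchords_label_change[OF assms])
  hence "chords (rotate C) = insert (nu (nchords C) i, nu (nchords C) j)
        (map_prod (nu (nchords C)) (nu (nchords C)) ` R)"
    "chords (rotate D) = insert (nu (nchords C) j, nu (nchords C) i)
        (map_prod (nu (nchords C)) (nu (nchords C)) ` R)"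
    using R by (simp_all only: chords_rotate image_insert map_prod_simp)
  thus ?thesis by (rule label_changeI)
qed

subsection \<open>Amalgamation\<close>

definition rooted :: "nat \<times> nat \<Rightarrow> bool" where
  "rooted c \<longleftrightarrow> fst c = 1 \<or> snd c = 1"

definition root_chord :: "(nat \<times> nat) set \<Rightarrow> nat \<times> nat" where
  "root_chord C = (THE c. c \<in> C \<and> rooted c)"

text \<open>
  The four cases are those of the amalgamated pair; they are exhaustive on rooted chords.
  On naturals, \<open>a + (2*m - 2)\<close> does not truncate for \<open>m \<ge> 1\<close>.
\<close>

fun join :: "nat \<Rightarrow> nat \<times> nat \<Rightarrow> nat \<times> nat \<Rightarrow> nat \<times> nat" where
  "join m (i, j) (a, b) =
     (if i = 1 \<and> a = 1 then (b + (2*m - 2), j - 1)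
      else if i = 1 \<and> b = 1 then (j - 1, a + (2*m - 2))
      else if j = 1 \<and> a = 1 then (i - 1, b + (2*m - 2))
      else (a + (2*m - 2), i - 1))"

definition star_chords :: "(nat \<times> nat) set \<Rightarrow> (nat \<times> nat) set \<Rightarrow> (nat \<times> nat) set" where
  "star_chords C D = (let m = card C; c = root_chord C; d = root_chord D in
     insert (join m c d)
       ((\<lambda>(i, j). (i - 1, j - 1)) ` (C - {c})
        \<union> (\<lambda>(a, b). (a + (2*m - 2), b + (2*m - 2))) ` (D - {d})))"

lemma ex_root:
  assumes "is_lcd m C" "m \<ge> 1"
  obtains c R where "C = insert c R" "c \<notin> R" "rooted c" "\<And>d. d \<in> R \<Longrightarrow> \<not> rooted d" "root_chord C = c"
proof -
  have "1 \<in> fst ` C \<union> snd ` C" using assms by (simp add: is_lcd_def)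
  then obtain c where c: "c \<in> C" "rooted c" unfolding rooted_def by auto
  have uniq: "d = c" if "d \<in> C" "rooted d" for d
    using is_lcd_unique[OF assms(1) that(1) c(1), of 1] that c by (auto simp: rooted_def)
  have "root_chord C = c" unfolding root_chord_def using c uniq by blast
  moreover have "C = insert c (C - {c})" using c by (simp add: insert_absorb)
  moreover have "\<not> rooted d" if "d \<in> C - {c}" for d using uniq that by blast
  ultimately show ?thesis using c(2) that[of c "C - {c}"] by simp
qed

lemma root_chord_eq:
  assumes "is_lcd m C" "C = insert c R" "rooted c"
  shows "root_chord C = c"
proof -
  have "d = c" if "d \<in> C" "rooted d" for d
    using is_lcd_unique[OF assms(1) that(1), of c 1] that assms by (auto simp: rooted_def)
  thus ?thesis unfolding root_chord_def using assms by blast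
qed

lemma star_chords_eq:
  assumes "is_lcd m C" "C = insert c R" "c \<notin> R" "rooted c"
    and "is_lcd l D" "D = insert d S" "d \<notin> S" "rooted d"
  shows "star_chords C D = insert (join m c d)
       ((\<lambda>(i, j). (i - 1, j - 1)) ` R \<union> (\<lambda>(a, b). (a + (2*m - 2), b + (2*m - 2))) ` S)"
proof -
  have "card C = m" using assms by (simp add: is_lcd_def)
  moreover have "C - {c} = R" "D - {d} = S" using assms by auto
  ultimately show ?thesis
    using root_chord_eq[OF assms(1,2,4)] root_chord_eq[OF assms(5,6,8)]
    by (simp only: star_chords_def Let_def)
qed

lemma is_lcd_star:
  assumes C: "is_lcd m C" "m \<ge> 1" and D: "is_lcd l D" "l \<ge> 1"
  shows "is_lcd (m + l - 1) (star_chords C D)"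
proof -
  obtain c R where c: "C = insert c R" "c \<notin> R" "rooted c" "\<And>d. d \<in> R \<Longrightarrow> \<not> rooted d"
    using ex_root[OF C] by metis
  obtain d S where d: "D = insert d S" "d \<notin> S" "rooted d" "\<And>e. e \<in> S \<Longrightarrow> \<not> rooted e"
    using ex_root[OF D] by metis
  let ?f = "\<lambda>(i::nat, j::nat). (i - 1, j - 1)"
  let ?g = "\<lambda>(a, b). (a + (2*m - 2), b + (2*m - 2))"
  have eq: "star_chords C D = insert (join m c d) (?f ` R \<union> ?g ` S)"
    by (rule star_chords_eq[OF C(1) c(1-3) D(1) d(1-3)])
  have fin: "finite R" "finite S" using C D c d by (auto simp: is_lcd_def)
  have card: "Suc (card R) = m" "Suc (card S) = l"
    using C D c d fin by (auto simp: is_lcd_def)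
  define x where "x = (if fst c = 1 then snd c else fst c)"
  define y where "y = (if fst d = 1 then snd d else fst d)"
  have cx: "{fst c, snd c} = {1, x}"
    using c(3) by (cases "fst c = 1") (simp_all add: rooted_def x_def insert_commute)
  have dy: "{fst d, snd d} = {1, y}"
    using d(3) by (cases "fst d = 1") (simp_all add: rooted_def y_def insert_commute)
  have cn: "fst c \<noteq> snd c" and dn: "fst d \<noteq> snd d"
    using is_lcd_neq[OF C(1), of c] is_lcd_neq[OF D(1), of d] c(1) d(1) by simp_all
  have x1: "x \<noteq> 1" and y1: "y \<noteq> 1"
    using cn dn c(3) d(3) by (auto simp: rooted_def x_def y_def)
  have J: "{fst (join m c d), snd (join m c d)} = {x - 1, y + (2*m - 2)}"
  proof -
    obtain i j a b where cd: "c = (i, j)" "d = (a, b)" by (metis surj_pair)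
    show ?thesis using c(3) d(3) unfolding cd x_def y_def
      by (cases "i = 1"; cases "a = 1") (simp_all add: rooted_def insert_commute)
  qed
  have RC: "{1, x} \<union> (fst ` R \<union> snd ` R) = {1..2*m}"
  proof -
    have "fst ` C \<union> snd ` C = {fst c, snd c} \<union> (fst ` R \<union> snd ` R)" unfolding c(1) by auto
    thus ?thesis using C(1) unfolding cx is_lcd_def by simp
  qed
  have SD: "{1, y} \<union> (fst ` S \<union> snd ` S) = {1..2*l}"
  proof -
    have "fst ` D \<union> snd ` D = {fst d, snd d} \<union> (fst ` S \<union> snd ` S)" unfolding d(1) by auto
    thus ?thesis using D(1) unfolding dy is_lcd_def by simp
  qed
  have R1: "1 \<notin> fst ` R \<union> snd ` R" and S1: "1 \<notin> fst ` S \<union> snd ` S"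
    using c(4) d(4) unfolding rooted_def by force+
  have RC': "insert x (fst ` R \<union> snd ` R) = {2..2*m}"
  proof -
    have "insert x (fst ` R \<union> snd ` R) = ({1, x} \<union> (fst ` R \<union> snd ` R)) - {1}"
      using x1 R1 by blast
    also have "\<dots> = {2..2*m}" unfolding RC by auto
    finally show ?thesis .
  qed
  have SD': "insert y (fst ` S \<union> snd ` S) = {2..2*l}"
  proof -
    have "insert y (fst ` S \<union> snd ` S) = ({1, y} \<union> (fst ` S \<union> snd ` S)) - {1}"
      using y1 S1 by blast
    also have "\<dots> = {2..2*l}" unfolding SD by auto
    finally show ?thesis .
  qed
  have "fst ` star_chords C D \<union> snd ` star_chords C D
     = {fst (join m c d), snd (join m c d)} \<union> (\<lambda>i. i - 1) ` (fst ` R \<union> snd ` R)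
        \<union> (\<lambda>a. a + (2*m - 2)) ` (fst ` S \<union> snd ` S)"
    unfolding eq by (simp add: image_Un image_image case_prod_unfold Un_ac)
      (rule insert_commute)
  also have "\<dots> = (\<lambda>i. i - 1) ` insert x (fst ` R \<union> snd ` R)
        \<union> (\<lambda>a. a + (2*m - 2)) ` insert y (fst ` S \<union> snd ` S)"
    unfolding J by (simp add: Un_ac) (rule insert_commute)
  also have "\<dots> = (\<lambda>i. i - 1) ` {2..2*m} \<union> (\<lambda>a. a + (2*m - 2)) ` {2..2*l}"
    unfolding RC' SD' by simp
  also have "(\<lambda>i. i - 1) ` {2..2*m} = {1..2*m - 1}"
  proof -
    have "k \<in> (\<lambda>i. i - 1) ` {2..2*m}" if "k \<in> {1..2*m-1}" for k
      using that by (intro image_eqI[of _ _ "Suc k"]) auto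
    thus ?thesis by fastforce
  qed
  also have "(\<lambda>a. a + (2*m - 2)) ` {2..2*l} = {2*m..2*m + 2*l - 2}"
  proof -
    have "2 + (2*m - 2) = 2*m" "2*l + (2*m - 2) = 2*m + 2*l - 2" using C(2) D(2) by auto
    thus ?thesis by (simp only: image_add_atLeastAtMost')
  qed
  also have "{1..2*m - 1} \<union> {2*m..2*m + 2*l - 2} = {1..2*(m + l - 1)}"
    using C(2) D(2) by auto
  finally have un: "fst ` star_chords C D \<union> snd ` star_chords C D = {1..2*(m + l - 1)}" .
  show ?thesis
  proof (rule is_lcd_I[OF _ _ un])
    show "finite (star_chords C D)" unfolding eq using fin by simp
    have "card (star_chords C D) \<le> Suc (card (?f ` R \<union> ?g ` S))"
      unfolding eq using card_insert_le_m1 fin by (simp add: card_insert_if)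
    also have "\<dots> \<le> Suc (card (?f ` R) + card (?g ` S))"
      using card_Un_le by simp
    also have "\<dots> \<le> Suc (card R + card S)"
      using card_image_le[OF fin(1), of ?f] card_image_le[OF fin(2), of ?g] by simp
    finally show "card (star_chords C D) \<le> m + l - 1" using card by simp
  qed
qed

lift_definition star :: "lcd \<Rightarrow> lcd \<Rightarrow> lcd" is star_chords
proof -
  fix C D :: "(nat \<times> nat) set"
  assume "\<exists>m\<ge>1. is_lcd m C" "\<exists>m\<ge>1. is_lcd m D"
  then obtain m l where "m \<ge> 1" "is_lcd m C" "l \<ge> 1" "is_lcd l D" by blast
  thus "\<exists>m\<ge>1. is_lcd m (star_chords C D)"
    using is_lcd_star[of m C l D] by (intro exI[of _ "m + l - 1"]) auto
qed

lemma nchords_star [simp]: "nchords (star C D) = nchords C + nchords D - 1"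
  using is_lcd_star[OF is_lcd_chords nchords_ge_1 is_lcd_chords nchords_ge_1, of C D]
  by (intro nchords_eqI) (simp only: star.rep_eq)

lifting_forget lcd.lifting

lemma rooted_swap: "rooted (j, i) \<longleftrightarrow> rooted (i, j)"
  by (auto simp: rooted_def)

lemma join_swap_left:
  assumes "rooted (i, j)" "i \<noteq> j" "rooted d" "fst d \<noteq> snd d"
  shows "join m (j, i) d = prod.swap (join m (i, j) d)"
  using assms by (cases d) (auto simp: rooted_def)

lemma join_swap_right:
  assumes "rooted (i, j)" "i \<noteq> j" "rooted d" "fst d \<noteq> snd d"
  shows "join m d (j, i) = prod.swap (join m d (i, j))"
  using assms by (cases d) (auto simp: rooted_def)

lemma root_label_change:
  assumes "label_change C D"
  obtains (root) i j R where "chords C = insert (i, j) R" "(i, j) \<notin> R"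
      "chords D = insert (j, i) R" "(j, i) \<notin> R" "rooted (i, j)" "i \<noteq> j"
  | (other) i j R c where "chords C = insert c (insert (i, j) R)" "c \<notin> insert (i, j) R"
      "chords D = insert c (insert (j, i) R)" "c \<notin> insert (j, i) R" "rooted c"
proof -
  obtain i j R where R: "chords C = insert (i, j) R" "(i, j) \<notin> R" "chords D = insert (j, i) R"
    using assms by (rule label_changeE)
  have ij: "i \<noteq> j" using is_lcd_neq[OF is_lcd_chords, of "(i,j)" C] R by simp
  have ji: "(j, i) \<notin> R"
  proof
    assume "(j, i) \<in> R"
    hence "(i, j) = (j, i)"
      by (intro is_lcd_unique[OF is_lcd_chords, of "(i,j)" C "(j,i)" i]) (simp_all add: R)
    hence "fst (i, j) = fst (j, i)" by (rule arg_cong)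
    thus False using ij by simp
  qed
  obtain c where c: "c \<in> chords C" "rooted c"
    using ex_root[OF is_lcd_chords[of C] nchords_ge_1] by (metis insertI1)
  show ?thesis
  proof (cases "c = (i, j)")
    case True
    show ?thesis by (rule root[OF R ji c(2)[unfolded True] ij])
  next
    case False
    hence cR: "c \<in> R" using c R by auto
    have "R = insert c (R - {c})" "c \<noteq> (i, j)" "c \<noteq> (j, i)" using cR False ji by auto
    hence "chords C = insert c (insert (i, j) (R - {c}))" "c \<notin> insert (i, j) (R - {c})"
      "chords D = insert c (insert (j, i) (R - {c}))" "c \<notin> insert (j, i) (R - {c})"
      using R by auto
    thus ?thesis using c(2) by (rule other)
  qed
qed

lemma label_change_star_left:
  assumes "label_change C D"
  shows "label_change (star C E) (star D E)"
proof -
  have n: "nchords D = nchords C" using nchords_label_change[OF assms] by simp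
  obtain e S where e: "chords E = insert e S" "e \<notin> S" "rooted e"
    using ex_root[OF is_lcd_chords[of E] nchords_ge_1] by metis
  have e2: "fst e \<noteq> snd e" using is_lcd_neq[OF is_lcd_chords, of e E] e by simp
  from assms show ?thesis
  proof (cases rule: root_label_change)
    case (root i j R)
    have r: "rooted (j, i)" using root by (simp add: rooted_swap)
    obtain a b where ab: "join (nchords C) (i, j) e = (a, b)" by fastforce
    hence ba: "join (nchords C) (j, i) e = (b, a)"
      using join_swap_left[OF root(5,6) e(3) e2] by simp
    show ?thesis
    proof (rule label_changeI)
      show "chords (star C E) = insert (a, b) ((\<lambda>(i, j). (i - 1, j - 1)) ` R \<union> (\<lambda>(a, b). (a + (2 * nchords C - 2), b + (2 * nchords C - 2))) ` S)"
        unfolding star.rep_eq star_chords_eq[OF is_lcd_chords root(1,2,5) is_lcd_chords e] ab by (rule refl)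
      show "chords (star D E) = insert (b, a) ((\<lambda>(i, j). (i - 1, j - 1)) ` R \<union> (\<lambda>(a, b). (a + (2 * nchords C - 2), b + (2 * nchords C - 2))) ` S)"
        unfolding star.rep_eq star_chords_eq[OF is_lcd_chords root(3,4) r is_lcd_chords e] n ba by (rule refl)
    qed
  next
    case (other i j R c)
    show ?thesis
    proof (rule label_changeI)
      show "chords (star C E) = insert (i - 1, j - 1) (insert (join (nchords C) c e) ((\<lambda>(i, j). (i - 1, j - 1)) ` R \<union> (\<lambda>(a, b). (a + (2 * nchords C - 2), b + (2 * nchords C - 2))) ` S))"
        unfolding star.rep_eq star_chords_eq[OF is_lcd_chords other(1,2,5) is_lcd_chords e] by auto
      show "chords (star D E) = insert (j - 1, i - 1) (insert (join (nchords C) c e) ((\<lambda>(i, j). (i - 1, j - 1)) ` R \<union> (\<lambda>(a, b). (a + (2 * nchords C - 2), b + (2 * nchords C - 2))) ` S))"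
        unfolding star.rep_eq star_chords_eq[OF is_lcd_chords other(3,4,5) is_lcd_chords e] n by auto
    qed
  qed
qed

lemma label_change_star_right:
  assumes "label_change C D"
  shows "label_change (star E C) (star E D)"
proof -
  obtain e S where e: "chords E = insert e S" "e \<notin> S" "rooted e"
    using ex_root[OF is_lcd_chords[of E] nchords_ge_1] by metis
  have e2: "fst e \<noteq> snd e" using is_lcd_neq[OF is_lcd_chords, of e E] e by simp
  from assms show ?thesis
  proof (cases rule: root_label_change)
    case (root i j R)
    have r: "rooted (j, i)" using root by (simp add: rooted_swap)
    obtain a b where ab: "join (nchords E) e (i, j) = (a, b)" by fastforce
    hence ba: "join (nchords E) e (j, i) = (b, a)"
      using join_swap_right[OF root(5,6) e(3) e2] by simp
    show ?thesis
    proof (rule label_changeI)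
      show "chords (star E C) = insert (a, b) ((\<lambda>(i, j). (i - 1, j - 1)) ` S \<union> (\<lambda>(a, b). (a + (2 * nchords E - 2), b + (2 * nchords E - 2))) ` R)"
        unfolding star.rep_eq star_chords_eq[OF is_lcd_chords e is_lcd_chords root(1,2,5)] ab by (rule refl)
      show "chords (star E D) = insert (b, a) ((\<lambda>(i, j). (i - 1, j - 1)) ` S \<union> (\<lambda>(a, b). (a + (2 * nchords E - 2), b + (2 * nchords E - 2))) ` R)"
        unfolding star.rep_eq star_chords_eq[OF is_lcd_chords e is_lcd_chords root(3,4) r] ba by (rule refl)
    qed
  next
    case (other i j R c)
    show ?thesis
    proof (rule label_changeI)
      show "chords (star E C) = insert (i + (2 * nchords E - 2), j + (2 * nchords E - 2)) (insert (join (nchords E) e c) ((\<lambda>(i, j). (i - 1, j - 1)) ` S \<union> (\<lambda>(a, b). (a + (2 * nchords E - 2), b + (2 * nchords E - 2))) ` R))"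
        unfolding star.rep_eq star_chords_eq[OF is_lcd_chords e is_lcd_chords other(1,2,5)] by auto
      show "chords (star E D) = insert (j + (2 * nchords E - 2), i + (2 * nchords E - 2)) (insert (join (nchords E) e c) ((\<lambda>(i, j). (i - 1, j - 1)) ` S \<union> (\<lambda>(a, b). (a + (2 * nchords E - 2), b + (2 * nchords E - 2))) ` R))"
        unfolding star.rep_eq star_chords_eq[OF is_lcd_chords e is_lcd_chords other(3,4,5)] by auto
    qed
  qed
qed

section \<open>The space of labeled linear chord diagrams modulo label changes\<close>

definition fscale :: "rat \<Rightarrow> ('a \<Rightarrow>\<^sub>0 rat) \<Rightarrow> ('a \<Rightarrow>\<^sub>0 rat)" where
  "fscale q = Poly_Mapping.map ((*) q)"

lemma lookup_fscale [simp]: "Poly_Mapping.lookup (fscale q f) C = q * Poly_Mapping.lookup f C"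
  by (simp add: fscale_def Poly_Mapping.map.rep_eq when_def)

interpretation free: vector_space fscale
  by unfold_locales
    (auto intro!: poly_mapping_eqI simp: lookup_add algebra_simps)

definition fextend :: "('a \<Rightarrow> ('b \<Rightarrow>\<^sub>0 rat)) \<Rightarrow> ('a \<Rightarrow>\<^sub>0 rat) \<Rightarrow> ('b \<Rightarrow>\<^sub>0 rat)" where
  "fextend h f = (\<Sum>C\<in>Poly_Mapping.keys f. fscale (Poly_Mapping.lookup f C) (h C))"

lemma fextend_superset:
  assumes "finite A" "Poly_Mapping.keys f \<subseteq> A"
  shows "fextend h f = (\<Sum>C\<in>A. fscale (Poly_Mapping.lookup f C) (h C))"
  unfolding fextend_def using assms
  by (intro sum.mono_neutral_left) (auto simp: in_keys_iff)

lemma fextend_add: "fextend h (f + g) = fextend h f + fextend h g"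
proof -
  let ?A = "Poly_Mapping.keys f \<union> Poly_Mapping.keys g"
  have "fextend h (f + g) = (\<Sum>C\<in>?A. fscale (Poly_Mapping.lookup (f + g) C) (h C))"
    by (rule fextend_superset) (auto simp: keys_add)
  also have "\<dots> = (\<Sum>C\<in>?A. fscale (Poly_Mapping.lookup f C) (h C)) + (\<Sum>C\<in>?A. fscale (Poly_Mapping.lookup g C) (h C))"
    by (simp add: lookup_add free.scale_left_distrib sum.distrib)
  also have "\<dots> = fextend h f + fextend h g"
    by (simp add: fextend_superset[of ?A])
  finally show ?thesis .
qed

lemma fextend_scale: "fextend h (fscale q f) = fscale q (fextend h f)"
proof -
  have "Poly_Mapping.keys (fscale q f) \<subseteq> Poly_Mapping.keys f" by (auto simp: in_keys_iff)
  hence "fextend h (fscale q f) = (\<Sum>C\<in>Poly_Mapping.keys f. fscale (Poly_Mapping.lookup (fscale q f) C) (h C))"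
    by (intro fextend_superset) auto
  also have "\<dots> = fscale q (fextend h f)"
    by (simp add: fextend_def free.scale_sum_right)
  finally show ?thesis .
qed

lemma fextend_single [simp]: "fextend h (Poly_Mapping.single C 1) = h C"
  by (simp add: fextend_def)

lemma fextend_zero [simp]: "fextend h 0 = 0"
  by (simp add: fextend_def)

lemma fextend_diff: "fextend h (f - g) = fextend h f - fextend h g"
  using fextend_add[of h "f - g" g] by (simp add: algebra_simps)

lemma fextend_fun_add: "fextend (\<lambda>C. h C + k C) f = fextend h f + fextend k f"
  by (simp add: fextend_def free.scale_right_distrib sum.distrib)

lemma fextend_fun_scale: "fextend (\<lambda>C. fscale q (h C)) f = fscale q (fextend h f)"
  by (simp add: fextend_def free.scale_sum_right mult.commute)

lemma fextend_fun_diff: "fextend (\<lambda>C. h C - k C) f = fextend h f - fextend k f"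
  by (simp add: fextend_def free.scale_right_diff_distrib sum_subtractf)

definition relations :: "(lcd \<Rightarrow>\<^sub>0 rat) set" where
  "relations = free.span
     {Poly_Mapping.single C 1 + Poly_Mapping.single C' 1 |C C'. label_change C C'}"

text \<open>
  All numbers of chords are treated at once: \<open>lc\<close> is the direct sum of the spaces
  \<open>\<L>\<C>\<^sub>m\<close> over \<open>m \<ge> 1\<close>, the relations being homogeneous.
\<close>

quotient_type lc = "lcd \<Rightarrow>\<^sub>0 rat" / "\<lambda>f g. f - g \<in> relations"
proof (rule equivpI)
  show "reflp (\<lambda>f g. f - g \<in> relations)"
    by (rule reflpI) (simp add: relations_def free.span_zero)
  show "symp (\<lambda>f g. f - g \<in> relations)"
  proof (rule sympI)
    fix f g assume "f - g \<in> relations"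
    hence "- (f - g) \<in> relations" unfolding relations_def by (rule free.span_neg)
    thus "g - f \<in> relations" by simp
  qed
  show "transp (\<lambda>f g. f - g \<in> relations)"
  proof (rule transpI)
    fix f g h assume "f - g \<in> relations" "g - h \<in> relations"
    hence "(f - g) + (g - h) \<in> relations" unfolding relations_def by (rule free.span_add)
    thus "f - h \<in> relations" by simp
  qed
qed

instantiation lc :: ab_group_add
begin

lift_definition zero_lc :: lc is 0 .

lift_definition plus_lc :: "lc \<Rightarrow> lc \<Rightarrow> lc" is "(+)"
proof -
  fix f f' g g' assume "f - f' \<in> relations" "g - g' \<in> relations"
  hence "(f - f') + (g - g') \<in> relations" unfolding relations_def by (rule free.span_add)
  thus "f + g - (f' + g') \<in> relations" by (simp only: add_diff_add)
qed

lift_definition uminus_lc :: "lc \<Rightarrow> lc" is uminus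
proof -
  fix f f' assume "f - f' \<in> relations"
  hence "- (f - f') \<in> relations" unfolding relations_def by (rule free.span_neg)
  thus "- f - - f' \<in> relations" by (simp only: minus_diff_minus)
qed

lift_definition minus_lc :: "lc \<Rightarrow> lc \<Rightarrow> lc" is "(-)"
proof -
  fix f f' g g' assume "f - f' \<in> relations" "g - g' \<in> relations"
  hence "(f - f') - (g - g') \<in> relations" unfolding relations_def by (rule free.span_diff)
  moreover have "f - g - (f' - g') = (f - f') - (g - g')" by simp
  ultimately show "f - g - (f' - g') \<in> relations" by (simp only:)
qed

instance
  by standard (transfer; simp add: relations_def free.span_zero algebra_simps)+

end

lift_definition lscale :: "rat \<Rightarrow> lc \<Rightarrow> lc" is fscale
proof -
  fix q f f' assume "f - f' \<in> relations"
  hence "fscale q (f - f') \<in> relations" unfolding relations_def by (rule free.span_scale)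
  thus "fscale q f - fscale q f' \<in> relations" by (simp only: free.scale_right_diff_distrib)
qed

interpretation lc: vector_space lscale
  by unfold_locales
    (transfer; simp add: relations_def free.span_zero free.scale_right_distrib
       free.scale_left_distrib)+

lift_definition lcd_class :: "lcd \<Rightarrow> lc" is "\<lambda>C. Poly_Mapping.single C 1" .

lemma fextend_relations:
  assumes "f \<in> relations"
    and "\<And>C C'. label_change C C' \<Longrightarrow> h C + h C' \<in> relations"
  shows "fextend h f \<in> relations"
  using assms(1) unfolding relations_def
proof (induction rule: free.span_induct_alt)
  case base
  show ?case by (simp add: free.span_zero)
next
  case (step q x y)
  then obtain C C' where "x = Poly_Mapping.single C 1 + Poly_Mapping.single C' 1" "label_change C C'"
    by blast
  hence "fextend h x \<in> relations" using assms(2) by (simp add: fextend_add)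
  thus ?case using step unfolding relations_def
    by (simp add: fextend_add fextend_scale free.span_add free.span_scale)
qed

lemma relations_base:
  "label_change C C' \<Longrightarrow> Poly_Mapping.single C 1 + Poly_Mapping.single C' 1 \<in> relations"
  unfolding relations_def by (rule free.span_base) blast

lemma fextend_mem_relations:
  assumes "\<And>C. h C \<in> relations"
  shows "fextend h f \<in> relations"
  using assms unfolding fextend_def relations_def
  by (intro free.span_sum free.span_scale) auto

lemma lcd_class_label_change: "label_change C C' \<Longrightarrow> lcd_class C' = - lcd_class C"
  by transfer (use relations_base in \<open>simp add: add.commute\<close>)

lift_definition rotate_lc :: "lc \<Rightarrow> lc" is "fextend (\<lambda>C. Poly_Mapping.single (rotate C) 1)"
  unfolding fextend_diff[symmetric]
  by (rule fextend_relations) (auto intro: relations_base label_change_rotate)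

lift_definition star_lc :: "lc \<Rightarrow> lc \<Rightarrow> lc" is
  "\<lambda>f g. fextend (\<lambda>C. fextend (\<lambda>D. Poly_Mapping.single (star C D) 1) g) f"
proof -
  fix f f' g g' :: "lcd \<Rightarrow>\<^sub>0 rat"
  let ?S = "\<lambda>f g. fextend (\<lambda>C. fextend (\<lambda>D. Poly_Mapping.single (star C D) 1) g) f"
  assume f: "f - f' \<in> relations" and g: "g - g' \<in> relations"
  have "?S (f - f') g \<in> relations"
  proof (rule fextend_relations[OF f])
    fix C C' assume "label_change C C'"
    hence "fextend (\<lambda>D. Poly_Mapping.single (star C D) 1 + Poly_Mapping.single (star C' D) 1) g
        \<in> relations"
      by (intro fextend_mem_relations relations_base label_change_star_left)
    thus "fextend (\<lambda>D. Poly_Mapping.single (star C D) 1) g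
        + fextend (\<lambda>D. Poly_Mapping.single (star C' D) 1) g \<in> relations"
      by (simp add: fextend_fun_add)
  qed
  moreover have "?S f' (g - g') \<in> relations"
    by (intro fextend_mem_relations fextend_relations[OF g] relations_base label_change_star_right)
  ultimately have "?S (f - f') g + ?S f' (g - g') \<in> relations"
    unfolding relations_def by (rule free.span_add)
  thus "?S f g - ?S f' g' \<in> relations"
    by (simp add: fextend_diff fextend_fun_diff)
qed

lemma rotate_lc_class [simp]: "rotate_lc (lcd_class C) = lcd_class (rotate C)"
  by transfer (simp add: relations_def free.span_zero)

lemma rotate_lc_add: "rotate_lc (x + y) = rotate_lc x + rotate_lc y"
  by transfer (simp add: fextend_add relations_def free.span_zero)

lemma rotate_lc_scale: "rotate_lc (lscale q x) = lscale q (rotate_lc x)"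
  by transfer (simp add: fextend_scale relations_def free.span_zero)

lemma star_lc_class [simp]: "star_lc (lcd_class C) (lcd_class D) = lcd_class (star C D)"
  by transfer (simp add: relations_def free.span_zero)

lemma star_lc_add_left: "star_lc (x + y) z = star_lc x z + star_lc y z"
  by transfer (simp add: fextend_add relations_def free.span_zero)

lemma star_lc_add_right: "star_lc x (y + z) = star_lc x y + star_lc x z"
  by transfer (simp add: fextend_add fextend_fun_add relations_def free.span_zero)

lemma star_lc_scale_left: "star_lc (lscale q x) y = lscale q (star_lc x y)"
  by transfer (simp add: fextend_scale relations_def free.span_zero)

lemma star_lc_scale_right: "star_lc x (lscale q y) = lscale q (star_lc x y)"
  by transfer (simp add: fextend_scale fextend_fun_scale relations_def free.span_zero)

definition LC :: "nat \<Rightarrow> lc set" where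
  "LC m = lc.span {lcd_class C |C. nchords C = m}"

text \<open>
  Homogeneity: a combination of diagrams with \<open>m\<close> chords that vanishes in \<open>lc\<close> is already
  a combination of label changes between diagrams with \<open>m\<close> chords.  Hence \<open>LC m\<close> is the
  quotient defined with \<open>m\<close>-chord diagrams alone.
\<close>

lemma relations_homogeneous:
  assumes "f \<in> relations" and supp: "\<And>C. C \<in> Poly_Mapping.keys f \<Longrightarrow> nchords C = m"
  shows "f \<in> free.span {Poly_Mapping.single C 1 + Poly_Mapping.single C' 1 |C C'.
           nchords C = m \<and> nchords C' = m \<and> label_change C C'}" (is "_ \<in> free.span ?R")
proof -
  define h where "h = (\<lambda>C. if nchords C = m then Poly_Mapping.single C (1::rat) else 0)"
  have "fextend h f \<in> free.span ?R"
    using assms(1) unfolding relations_def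
  proof (induction rule: free.span_induct_alt)
    case base
    show ?case by (simp add: free.span_zero)
  next
    case (step q x y)
    then obtain C C' where x: "x = Poly_Mapping.single C 1 + Poly_Mapping.single C' 1"
      and CC: "label_change C C'"
      by blast
    have "fextend h x \<in> free.span ?R"
    proof (cases "nchords C = m")
      case True
      hence "nchords C' = m" using nchords_label_change[OF CC] by simp
      hence "fextend h x = Poly_Mapping.single C 1 + Poly_Mapping.single C' 1"
        using True by (simp add: x fextend_add h_def)
      moreover have "Poly_Mapping.single C 1 + Poly_Mapping.single C' 1 \<in> ?R"
        using True \<open>nchords C' = m\<close> CC by (intro CollectI exI[of _ C] exI[of _ C']) simp
      ultimately show ?thesis by (simp only: free.span_base)
    next
      case False
      hence "nchords C' \<noteq> m" using nchords_label_change[OF CC] by simp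
      hence "fextend h x = 0" using False by (simp add: x fextend_add h_def)
      thus ?thesis by (simp add: free.span_zero)
    qed
    thus ?case using step(2)
      by (simp add: fextend_add fextend_scale free.span_add free.span_scale)
  qed
  moreover have "fextend h f = f"
  proof (rule poly_mapping_eqI)
    fix D
    have lookup_sum: "Poly_Mapping.lookup (sum g A) D = (\<Sum>C\<in>A. Poly_Mapping.lookup (g C) D)"
      for g :: "lcd \<Rightarrow> lcd \<Rightarrow>\<^sub>0 rat" and A
      by (induction A rule: infinite_finite_induct) (simp_all add: lookup_add)
    have "Poly_Mapping.lookup (fextend h f) D
        = (\<Sum>C\<in>Poly_Mapping.keys f. Poly_Mapping.lookup f C * (if C = D then 1 else 0))"
      unfolding fextend_def lookup_sum
      by (intro sum.cong refl) (simp add: supp h_def lookup_single when_def)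
    also have "\<dots> = (\<Sum>C\<in>Poly_Mapping.keys f. if C = D then Poly_Mapping.lookup f C else 0)"
      by (intro sum.cong) auto
    also have "\<dots> = Poly_Mapping.lookup f D"
      by (simp add: in_keys_iff)
    finally show "Poly_Mapping.lookup (fextend h f) D = Poly_Mapping.lookup f D" .
  qed
  ultimately show ?thesis by simp
qed

lemma rotate_lc_zero [simp]: "rotate_lc 0 = 0"
  using rotate_lc_add[of 0 0] by simp

lemma rotate_lc_funpow_add: "(rotate_lc ^^ s) (x + y) = (rotate_lc ^^ s) x + (rotate_lc ^^ s) y"
  by (induction s) (simp_all add: rotate_lc_add)

lemma rotate_lc_funpow_zero [simp]: "(rotate_lc ^^ s) 0 = 0"
  by (induction s) simp_all

lemma rotate_lc_funpow_scale: "(rotate_lc ^^ s) (lscale q x) = lscale q ((rotate_lc ^^ s) x)"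
  by (induction s) (simp_all add: rotate_lc_scale)

lemma rotate_lc_funpow_class [simp]: "(rotate_lc ^^ s) (lcd_class C) = lcd_class ((rotate ^^ s) C)"
  by (induction s) simp_all

lemma rotate_lc_sum: "rotate_lc (\<Sum>i\<in>A. f i) = (\<Sum>i\<in>A. rotate_lc (f i))"
  by (induction A rule: infinite_finite_induct) (simp_all add: rotate_lc_add)

lemma LC_class: "lcd_class C \<in> LC (nchords C)"
  unfolding LC_def by (rule lc.span_base) blast

lemma LC_induct [consumes 1, case_names zero step]:
  assumes "x \<in> LC m" "P 0"
    and "\<And>q C y. nchords C = m \<Longrightarrow> P y \<Longrightarrow> P (lscale q (lcd_class C) + y)"
  shows "P x"
  using assms(1) unfolding LC_def
  by (induction rule: lc.span_induct_alt) (use assms(2,3) in blast)+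

lemma LC_rotate: "x \<in> LC m \<Longrightarrow> rotate_lc x \<in> LC m"
proof (induction rule: LC_induct)
  case zero
  show ?case by (simp add: LC_def lc.span_zero)
next
  case (step q C y)
  have "lcd_class (rotate C) \<in> LC m" using LC_class[of "rotate C"] step(1) by simp
  thus ?case using step(2)
    by (simp add: rotate_lc_add rotate_lc_scale LC_def lc.span_add lc.span_scale)
qed

lemma LC_rotate_funpow: "x \<in> LC m \<Longrightarrow> (rotate_lc ^^ s) x \<in> LC m"
  by (induction s) (simp_all add: LC_rotate)

lemma rotate_lc_order: "x \<in> LC m \<Longrightarrow> (rotate_lc ^^ (2*m)) x = x"
proof (induction rule: LC_induct)
  case zero
  show ?case by simp
next
  case (step q C y)
  thus ?case using rotate_order[of C] by (simp add: rotate_lc_funpow_add rotate_lc_funpow_scale)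
qed

lemma star_lc_zero_left [simp]: "star_lc 0 y = 0"
  using star_lc_add_left[of 0 0 y] by simp

lemma star_lc_zero_right [simp]: "star_lc x 0 = 0"
  using star_lc_add_right[of x 0 0] by simp

lemma star_lc_sum_left: "star_lc (\<Sum>i\<in>A. f i) y = (\<Sum>i\<in>A. star_lc (f i) y)"
  by (induction A rule: infinite_finite_induct) (simp_all add: star_lc_add_left)

lemma star_lc_sum_right: "star_lc x (\<Sum>i\<in>A. f i) = (\<Sum>i\<in>A. star_lc x (f i))"
  by (induction A rule: infinite_finite_induct) (simp_all add: star_lc_add_right)

lemma LC_star:
  assumes "x \<in> LC m" "y \<in> LC l"
  shows "star_lc x y \<in> LC (m + l - 1)"
  using assms(1)
proof (induction rule: LC_induct)
  case zero
  show ?case by (simp add: LC_def lc.span_zero)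
next
  case (step q C x)
  have "star_lc (lcd_class C) y \<in> LC (m + l - 1)"
    using assms(2)
  proof (induction rule: LC_induct)
    case zero
    show ?case by (simp add: LC_def lc.span_zero)
  next
    case (step r D y)
    have "lcd_class (star C D) \<in> LC (m + l - 1)"
      using LC_class[of "star C D"] step(1) \<open>nchords C = m\<close> by simp
    thus ?case using step(2)
      by (simp add: star_lc_add_right star_lc_scale_right LC_def lc.span_add lc.span_scale)
  qed
  thus ?case using step(2)
    by (simp add: star_lc_add_left star_lc_scale_left LC_def lc.span_add lc.span_scale)
qed

section \<open>Oriented chord diagrams\<close>

definition cyc :: "nat \<Rightarrow> lc set" where
  "cyc m = {x \<in> LC m. \<forall>s. (rotate_lc ^^ s) x = x}"

definition closing :: "lcd \<Rightarrow> lc" where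
  "closing C = (\<Sum>s<2 * nchords C. lcd_class ((rotate ^^ s) C))"

definition closing_lc :: "nat \<Rightarrow> lc \<Rightarrow> lc" where
  "closing_lc m x = (\<Sum>s<2*m. (rotate_lc ^^ s) x)"

lemma closing_lc_class: "nchords C = m \<Longrightarrow> closing_lc m (lcd_class C) = closing C"
  by (simp add: closing_lc_def closing_def)

lemma closing_lc_add: "closing_lc m (x + y) = closing_lc m x + closing_lc m y"
  by (simp add: closing_lc_def rotate_lc_funpow_add sum.distrib)

lemma closing_lc_scale: "closing_lc m (lscale q x) = lscale q (closing_lc m x)"
  by (simp add: closing_lc_def rotate_lc_funpow_scale lc.scale_sum_right)

lemma closing_lc_zero [simp]: "closing_lc m 0 = 0"
  by (simp add: closing_lc_def)

lemma closing_lc_sum: "closing_lc m (\<Sum>i\<in>A. f i) = (\<Sum>i\<in>A. closing_lc m (f i))"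
  by (induction A rule: infinite_finite_induct) (simp_all add: closing_lc_add)

lemma closing_lc_cyc:
  assumes "x \<in> LC m"
  shows "closing_lc m x \<in> cyc m"
proof -
  let ?f = "\<lambda>s. (rotate_lc ^^ s) x"
  have "closing_lc m x \<in> LC m"
    using LC_rotate_funpow[OF assms] unfolding closing_lc_def LC_def by (intro lc.span_sum) auto
  moreover have rot: "rotate_lc (closing_lc m x) = closing_lc m x"
  proof -
    have "rotate_lc (closing_lc m x) + ?f 0 = (\<Sum>s<Suc (2*m). ?f s)"
      unfolding closing_lc_def rotate_lc_sum by (subst sum.lessThan_Suc_shift) (simp add: add.commute)
    also have "\<dots> = closing_lc m x + ?f 0"
      using rotate_lc_order[OF assms] by (simp add: closing_lc_def)
    finally show ?thesis by simp
  qed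
  moreover have "(rotate_lc ^^ s) (closing_lc m x) = closing_lc m x" for s
    by (induction s) (simp_all add: rot)
  ultimately show ?thesis by (simp add: cyc_def)
qed

lemma closing_mem_cyc: "closing C \<in> cyc (nchords C)"
  using closing_lc_cyc[OF LC_class] by (simp add: closing_lc_class)

lemma subspace_cyc: "lc.subspace (cyc m)"
  by (rule lc.subspaceI)
     (auto simp: cyc_def LC_def lc.span_zero lc.span_add lc.span_scale
        rotate_lc_funpow_add rotate_lc_funpow_scale)

lemma closing_span:
  assumes "m \<ge> 1"
  shows "lc.span {closing C |C. nchords C = m} = cyc m"
proof
  have "{closing C |C. nchords C = m} \<subseteq> cyc m" using closing_mem_cyc by blast
  thus "lc.span {closing C |C. nchords C = m} \<subseteq> cyc m"
    by (rule lc.span_minimal[OF _ subspace_cyc])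
  show "cyc m \<subseteq> lc.span {closing C |C. nchords C = m}"
  proof
    fix x assume x: "x \<in> cyc m"
    hence "x \<in> LC m" by (simp add: cyc_def)
    hence "closing_lc m x \<in> lc.span {closing C |C. nchords C = m}"
    proof (induction rule: LC_induct)
      case zero
      show ?case by (simp add: lc.span_zero)
    next
      case (step q C y)
      have "closing C \<in> lc.span {closing C |C. nchords C = m}"
        using step(1) by (intro lc.span_base) blast
      thus ?case using step
        by (simp add: closing_lc_add closing_lc_scale closing_lc_class lc.span_add lc.span_scale)
    qed
    hence "lscale (inverse (of_nat (2*m))) (closing_lc m x)
        \<in> lc.span {closing C |C. nchords C = m}"
      by (rule lc.span_scale)
    moreover have "closing_lc m x = lscale (of_nat (2*m)) x"
    proof -
      have const: "(\<Sum>s<n. x) = lscale (of_nat n) x" for n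
        by (induction n) (simp_all add: lc.scale_left_distrib add.commute)
      have "closing_lc m x = (\<Sum>s<2*m. x)"
        using x unfolding closing_lc_def cyc_def by simp
      thus ?thesis by (simp only: const)
    qed
    ultimately show "x \<in> lc.span {closing C |C. nchords C = m}" using assms by simp
  qed
qed

lemma cyc_1: "cyc 1 = {0}"
proof -
  have "closing C = 0" if C: "nchords C = 1" for C
  proof -
    have "card (chords C) = 1" using C by (simp add: nchords_def)
    then obtain c where c: "chords C = {c}" by (rule card_1_singletonE)
    obtain i j where ij: "c = (i, j)" by fastforce
    have 2: "{i, j} = {1, 2}"
    proof -
      have "fst ` chords C \<union> snd ` chords C = {1..2}"
        using is_lcd_chords[of C] by (simp add: is_lcd_def C)
      moreover have "fst ` chords C \<union> snd ` chords C = {i, j}" unfolding c ij by auto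
      moreover have "{1..2} = {1, 2::nat}" by auto
      ultimately show ?thesis by (simp only:)
    qed
    hence "i = 1 \<and> j = 2 \<or> i = 2 \<and> j = 1" by (simp only: doubleton_eq_iff)
    hence "nu 1 i = j \<and> nu 1 j = i" by (elim disjE) (simp_all add: nu_def)
    hence "chords (rotate C) = insert (j, i) {}" by (simp add: chords_rotate C c ij)
    moreover have "chords C = insert (i, j) {}" by (simp add: c ij)
    ultimately have "lcd_class (rotate C) = - lcd_class C"
      by (intro lcd_class_label_change label_changeI)
    thus ?thesis by (simp add: closing_def C numeral_2_eq_2)
  qed
  hence "{closing C |C. nchords C = 1} \<subseteq> {0}" by auto
  hence "lc.span {closing C |C. nchords C = 1} \<subseteq> {0}"
    by (rule lc.span_minimal) (simp add: lc.subspace_single_0)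
  moreover have "0 \<in> cyc 1" using subspace_cyc by (rule lc.subspace_0)
  ultimately show ?thesis using closing_span[of 1] by auto
qed

subsection \<open>The Lie bracket\<close>

text \<open>
  Since amalgamation is bilinear on \<open>lc\<close> and \<open>closing C\<close> is the sum of the rotations of \<open>C\<close>,
  the double sum defining the bracket of two closings is the closing of their amalgamation
  (\<open>bracket_closing\<close>); this form does not depend on the choice of representatives.
\<close>

definition bracket :: "nat \<Rightarrow> nat \<Rightarrow> lc \<Rightarrow> lc \<Rightarrow> lc" where
  "bracket m l x y = closing_lc (m + l - 1) (star_lc x y)"

lemma bracket_closing:
  assumes "nchords C = m" "nchords D = l"
  shows "bracket m l (closing C) (closing D) =
    (\<Sum>s<2*m. \<Sum>t<2*l. closing (star ((rotate ^^ s) C) ((rotate ^^ t) D)))"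
  using assms
  by (simp add: bracket_def closing_def[of C] closing_def[of D] star_lc_sum_left star_lc_sum_right
        closing_lc_sum closing_lc_class) (rule sum.swap)

lemma bracket_add_left: "bracket m l (x + y) z = bracket m l x z + bracket m l y z"
  and bracket_add_right: "bracket m l x (y + z) = bracket m l x y + bracket m l x z"
  and bracket_scale_left: "bracket m l (lscale q x) y = lscale q (bracket m l x y)"
  and bracket_scale_right: "bracket m l x (lscale q y) = lscale q (bracket m l x y)"
  by (simp_all add: bracket_def star_lc_add_left star_lc_add_right star_lc_scale_left
        star_lc_scale_right closing_lc_add closing_lc_scale)

lemma bracket_mem_cyc: "x \<in> cyc m \<Longrightarrow> y \<in> cyc l \<Longrightarrow> bracket m l x y \<in> cyc (m + l - 1)"
  unfolding bracket_def by (intro closing_lc_cyc LC_star) (auto simp: cyc_def)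

text \<open>
  An element of a product over \<open>m \<ge> 2\<close> is a sequence indexed by \<open>nat\<close> with the junk
  components \<open>0\<close> and \<open>1\<close> set to zero.
\<close>

definition graded_product :: "(nat \<Rightarrow> lc set) \<Rightarrow> (nat \<Rightarrow> lc) set" where
  "graded_product A = {z. (\<forall>m<2. z m = 0) \<and> (\<forall>m\<ge>2. z m \<in> A m)}"

definition chord_algebra :: "(nat \<Rightarrow> lc) set" where
  "chord_algebra = graded_product cyc"

definition lie_bracket :: "(nat \<Rightarrow> lc) \<Rightarrow> (nat \<Rightarrow> lc) \<Rightarrow> nat \<Rightarrow> lc" where
  "lie_bracket z w n = (\<Sum>(m, l) | 2 \<le> m \<and> 2 \<le> l \<and> m + l - 1 = n. bracket m l (z m) (w l))"

lemma finite_bracket_index: "finite {(m, l). 2 \<le> m \<and> 2 \<le> l \<and> m + l - 1 = (n::nat)}"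
  by (rule finite_subset[of _ "{..n} \<times> {..n}"]) auto

lemma lie_bracket_mem:
  assumes "z \<in> chord_algebra" "w \<in> chord_algebra"
  shows "lie_bracket z w \<in> chord_algebra"
proof -
  have "lie_bracket z w n \<in> cyc n" for n
    unfolding lie_bracket_def
  proof (rule lc.subspace_sum[OF subspace_cyc])
    fix p :: "nat \<times> nat" assume p: "p \<in> {(m, l). 2 \<le> m \<and> 2 \<le> l \<and> m + l - 1 = n}"
    obtain m l where ml: "p = (m, l)" by fastforce
    have "z m \<in> cyc m" "w l \<in> cyc l"
      using assms p ml by (auto simp: chord_algebra_def graded_product_def)
    hence "bracket m l (z m) (w l) \<in> cyc (m + l - 1)" by (rule bracket_mem_cyc)
    thus "(case p of (m, l) \<Rightarrow> bracket m l (z m) (w l)) \<in> cyc n" using p ml by simp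
  qed
  moreover have "lie_bracket z w n = 0" if "n < 2" for n
  proof -
    have "{(m, l). 2 \<le> m \<and> 2 \<le> l \<and> m + l - 1 = n} = {}" using that by auto
    thus ?thesis unfolding lie_bracket_def by (simp only: sum.empty)
  qed
  ultimately show ?thesis by (simp add: chord_algebra_def graded_product_def)
qed

definition lie_center :: "(nat \<Rightarrow> lc) set" where
  "lie_center = {z \<in> chord_algebra. \<forall>w\<in>chord_algebra. lie_bracket z w = (\<lambda>_. 0)}"

subsection \<open>The elements \<open>\<Omega>\<^sub>m\<close>\<close>

definition Omega_lcd :: "nat \<Rightarrow> lcd" where
  "Omega_lcd m = Abs_lcd {(2*k - 1, 2*k) |k. k \<in> {1..m}}"

lemma chords_Omega_lcd:
  assumes "m \<ge> 1"
  shows "chords (Omega_lcd m) = {(2*k - 1, 2*k) |k. k \<in> {1..m}}"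
proof -
  let ?O = "(\<lambda>k. (2*k - 1, 2*k)) ` {1..m}"
  have "fst ` ?O \<union> snd ` ?O = {1..2*m}"
  proof
    show "fst ` ?O \<union> snd ` ?O \<subseteq> {1..2*m}" by auto
    show "{1..2*m} \<subseteq> fst ` ?O \<union> snd ` ?O"
    proof
      fix x assume x: "x \<in> {1..2*m}"
      show "x \<in> fst ` ?O \<union> snd ` ?O"
      proof (cases "even x")
        case True
        then obtain k where k: "x = 2 * k" by (rule evenE)
        hence "x = snd (2*k - 1, 2*k)" "k \<in> {1..m}" using x by auto
        thus ?thesis by blast
      next
        case False
        then obtain k where k: "x = 2 * k + 1" by (rule oddE)
        hence "x = fst (2 * Suc k - 1, 2 * Suc k)" "Suc k \<in> {1..m}" using x by auto
        thus ?thesis by blast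
      qed
    qed
  qed
  hence "is_lcd m ?O" using card_image_le[of "{1..m}" "\<lambda>k. (2*k - 1, 2*k)"]
    by (intro is_lcd_I) auto
  moreover have "{(2*k - 1, 2*k) |k. k \<in> {1..m}} = ?O" by (simp only: Setcompr_eq_image)
  ultimately show ?thesis unfolding Omega_lcd_def using assms
    by (subst Abs_lcd_inverse) auto
qed

definition Omega :: "nat \<Rightarrow> lc" where
  "Omega m = closing (Omega_lcd m)"

end

theory Submission
  imports Defs
begin

text \<open>
  Forgetting orientations, a diagram is a matching of \<open>{1..2m}\<close> together with a sign, and rotation
  and amalgamation both reverse the sign relative to the increasing orientation of all chords.

  \<open>\<Omega>\<^sub>l\<close> is \<open>l\<close> times the sum of \<open>{(1,2),(3,4),\<dots>}\<close> and its rotation.  Amalgamating \<open>C\<close> with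
  the former inserts \<open>l - 1\<close> isolated chords just after the root of \<open>C\<close>; amalgamating the rotation of
  \<open>C\<close> with the latter inserts them just before the next point, with the opposite sign.  Hence the
  bracket with \<open>\<Omega>\<^sub>l\<close> vanishes on rotation invariant elements.

  Conversely, let \<open>x\<close> have \<open>m\<close> chords and bracket trivially with the closing of a diagram \<open>D\<close> all of
  whose chords are longer than \<open>2m\<close>.  Let \<open>C\<close> occur in \<open>x\<close> and have a chord which does not join
  cyclically adjacent points, and root \<open>C\<close> at it.  In the amalgamation of \<open>C\<close> with \<open>D\<close> the arc
  \<open>{1..2m-1}\<close> coming from \<open>C\<close> is left by a single chord, and it is the only such arc of its length:
  any other one contains a point of \<open>D\<close>, whose long chord leaves the arc, and either a second such
  point or the end of the root chord.  So \<open>C\<close> can be read off the amalgamation, and its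
  coefficient in \<open>x\<close> is zero.  The diagrams without such a chord are \<open>{(1,2),(3,4),\<dots>}\<close> and its
  rotation, and the rotation invariant combinations of these two are the multiples of \<open>\<Omega>\<^sub>m\<close>.
\<close>

section \<open>Matchings and signs\<close>

text \<open>A symmetric relation rather than a set of unordered pairs: the partner of a point is
  given by an ordinary relation, with no case split on the orientation of its chord.\<close>

definition und :: "lcd \<Rightarrow> (nat \<times> nat) set" where
  "und C = chords C \<union> (chords C)\<inverse>"

definition orient :: "nat \<times> nat \<Rightarrow> rat" where
  "orient c = (if fst c < snd c then 1 else - 1)"

definition sgn_lcd :: "lcd \<Rightarrow> rat" where
  "sgn_lcd C = (\<Prod>c\<in>chords C. orient c)"

lemma und_sym: "(i, j) \<in> und C \<Longrightarrow> (j, i) \<in> und C"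
  by (auto simp: und_def)

lemma und_range:
  assumes "(i, j) \<in> und C"
  shows "1 \<le> i" "i \<le> 2 * nchords C" "1 \<le> j" "j \<le> 2 * nchords C"
proof -
  have "fst ` chords C \<union> snd ` chords C = {1..2 * nchords C}"
    using is_lcd_chords by (simp add: is_lcd_def)
  moreover have "i \<in> fst ` chords C \<union> snd ` chords C" "j \<in> fst ` chords C \<union> snd ` chords C"
    using assms unfolding und_def by (metis UnCI UnE converseD fst_conv image_eqI snd_conv)+
  ultimately show "1 \<le> i" "i \<le> 2 * nchords C" "1 \<le> j" "j \<le> 2 * nchords C" by simp_all
qed

lemma und_total:
  assumes "1 \<le> i" "i \<le> 2 * nchords C"
  obtains j where "(i, j) \<in> und C"
proof -
  have "fst ` chords C \<union> snd ` chords C = {1..2 * nchords C}"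
    using is_lcd_chords by (simp add: is_lcd_def)
  hence "i \<in> fst ` chords C \<union> snd ` chords C" using assms by simp
  thus ?thesis using that unfolding und_def by fastforce
qed

lemma und_neq: "(i, j) \<in> und C \<Longrightarrow> i \<noteq> j"
  using is_lcd_neq[OF is_lcd_chords, of "(i, j)" C] is_lcd_neq[OF is_lcd_chords, of "(j, i)" C]
  by (auto simp: und_def)

lemma und_unique:
  assumes "(i, j) \<in> und C" "(i, k) \<in> und C"
  shows "j = k"
proof -
  have U: "c = d" if "c \<in> chords C" "d \<in> chords C" "i = fst c \<or> i = snd c" "i = fst d \<or> i = snd d" for c d
    by (rule is_lcd_unique[OF is_lcd_chords that])
  have "(i, j) \<in> chords C \<or> (j, i) \<in> chords C" "(i, k) \<in> chords C \<or> (k, i) \<in> chords C"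
    using assms by (auto simp: und_def)
  thus ?thesis
    by (elim disjE) (metis U fst_conv snd_conv)+
qed

text \<open>Every point has exactly one partner on either side, so an inclusion between matchings of
  equal size is an equality.\<close>

lemma und_subset_eq:
  assumes "und C \<subseteq> und D" "nchords C = nchords D"
  shows "und C = und D"
proof (rule equalityI[OF assms(1)], rule subrelI)
  fix i j assume ij: "(i, j) \<in> und D"
  then obtain k where k: "(i, k) \<in> und C" using und_total[of i C] und_range[OF ij] assms(2) by metis
  thus "(i, j) \<in> und C" using und_unique[OF ij, of k] assms(1) by auto
qed

lemma und_rotate: "und (rotate C) = map_prod (nu (nchords C)) (nu (nchords C)) ` und C"
  unfolding und_def chords_rotate by (auto simp: image_Un)

lemma und_rotate_funpow:
  "und ((rotate ^^ s) C) = map_prod (nu (nchords C) ^^ s) (nu (nchords C) ^^ s) ` und C"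
  unfolding und_def chords_rotate_funpow by (auto simp: image_Un)

lemma inj_on_nu: "inj_on (nu m) {1..2*m}"
  by (auto simp: inj_on_def nu_def split: if_splits)

lemma nu_funpow_explicit:
  assumes "1 \<le> i" "i \<le> 2 * m" "r \<le> 2 * m"
  shows "(nu m ^^ r) i = (if r < i then i - r else i + 2 * m - r)"
  using assms(3)
proof (induction r)
  case 0
  thus ?case using assms by simp
next
  case (Suc r)
  thus ?case using assms by (auto simp: nu_def)
qed

lemma und_rotate_inj:
  assumes "und (rotate C) = und (rotate D)" "nchords C = nchords D"
  shows "und C = und D"
proof (rule und_subset_eq[OF _ assms(2)], rule subrelI)
  fix i j assume ij: "(i, j) \<in> und C"
  let ?m = "nchords D"
  have "(nu ?m i, nu ?m j) \<in> und (rotate D)"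
    unfolding assms(1)[symmetric] unfolding und_rotate assms(2) by (rule map_prod_imageI[OF ij])
  then obtain i' j' where ij': "(i', j') \<in> und D" "nu ?m i = nu ?m i'" "nu ?m j = nu ?m j'"
    unfolding und_rotate by auto
  hence "i = i'" "j = j'"
    using inj_onD[OF inj_on_nu[of ?m]] und_range[OF ij] und_range[OF ij'(1)] assms(2) by auto
  thus "(i, j) \<in> und D" using ij' by simp
qed

lemma und_rotate_funpow_inj:
  assumes "und ((rotate ^^ s) C) = und ((rotate ^^ s) D)" "nchords C = nchords D"
  shows "und C = und D"
  using assms(1)
proof (induction s)
  case (Suc s)
  show ?case by (rule Suc.IH, rule und_rotate_inj) (use Suc.prems assms(2) in simp_all)
qed simp

lemma lcd_eqI:
  assumes "chords C \<subseteq> chords D" "nchords C = nchords D"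
  shows "C = D"
proof -
  have "finite (chords D)" using is_lcd_chords by (simp add: is_lcd_def)
  hence "chords C = chords D" using card_subset_eq assms by (simp add: nchords_def)
  thus ?thesis by (simp add: chords_inject)
qed

lemma finite_chords: "finite (chords C)"
  using is_lcd_chords by (simp add: is_lcd_def)

lemma und_label_change: "label_change C D \<Longrightarrow> und D = und C"
  by (erule label_changeE) (auto simp: und_def)

section \<open>Signs under label changes and rotation\<close>

lemma orient_swap: "i \<noteq> j \<Longrightarrow> orient (j, i) = - orient (i, j)"
  by (simp add: orient_def)

lemma orient_square [simp]: "orient c * orient c = 1"
  by (simp add: orient_def)

lemma sgn_lcd_square [simp]: "sgn_lcd C * sgn_lcd C = 1"
  unfolding sgn_lcd_def by (simp flip: prod.distrib)

lemma sgn_lcd_nonzero [simp]: "sgn_lcd C \<noteq> 0"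
  by (metis mult_zero_left sgn_lcd_square zero_neq_one)

lemma sgn_lcd_insert:
  assumes "chords C = insert c R" "c \<notin> R"
  shows "sgn_lcd C = orient c * (\<Prod>d\<in>R. orient d)"
  using finite_chords[of C] assms by (simp add: sgn_lcd_def)

lemma chord_swap_notin:
  assumes "chords C = insert (i, j) R" "(i, j) \<notin> R"
  shows "(j, i) \<notin> R"
proof
  assume "(j, i) \<in> R"
  hence "(i, j) = (j, i)"
    by (intro is_lcd_unique[OF is_lcd_chords, of "(i,j)" C "(j,i)" i]) (simp_all add: assms)
  thus False using \<open>(j, i) \<in> R\<close> assms(2) by metis
qed

lemma sgn_lcd_label_change:
  assumes "label_change C D"
  shows "sgn_lcd D = - sgn_lcd C"
proof -
  obtain i j R where R: "chords C = insert (i, j) R" "(i, j) \<notin> R" "chords D = insert (j, i) R"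
    using assms by (rule label_changeE)
  have "i \<noteq> j" using is_lcd_neq[OF is_lcd_chords, of "(i,j)" C] R(1) by simp
  thus ?thesis
    by (simp add: sgn_lcd_insert[OF R(1,2)] sgn_lcd_insert[OF R(3) chord_swap_notin[OF R(1,2)]] orient_swap[of i j])
qed

lemma ex_label_change:
  assumes "(i, j) \<in> chords C"
  obtains C' where "label_change C C'" "chords C' = insert (j, i) (chords C - {(i, j)})"
proof -
  let ?X = "insert (j, i) (chords C - {(i, j)})"
  have "is_lcd (nchords C) ?X"
  proof (rule is_lcd_I)
    have "card ?X \<le> Suc (card (chords C - {(i, j)}))"
      by (rule card_insert_le_m1) (auto simp: finite_chords)
    also have "\<dots> = nchords C" using assms finite_chords[of C]
      by (metis card_Suc_Diff1 nchords_def)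
    finally show "card ?X \<le> nchords C" .
    have "{1..2 * nchords C} = fst ` chords C \<union> snd ` chords C"
      using is_lcd_chords by (simp add: is_lcd_def)
    also have "chords C = insert (i, j) (chords C - {(i, j)})" using assms by auto
    finally show "fst ` ?X \<union> snd ` ?X = {1..2 * nchords C}" by auto
  qed (simp add: finite_chords)
  hence "chords (Abs_lcd ?X) = ?X" using nchords_ge_1[of C] by (subst Abs_lcd_inverse) auto
  thus ?thesis using that[of "Abs_lcd ?X"] assms unfolding label_change_def by blast
qed

text \<open>Induction on the number of chords of \<open>C\<close> absent from \<open>D\<close>: such
  a chord occurs reversed in \<open>D\<close>, and reversing it in \<open>C\<close> negates both the
  class and the sign of \<open>C\<close>.\<close>

lemma lcd_class_und_eq:
  assumes "und C = und D"
  shows "lcd_class D = lscale (sgn_lcd C * sgn_lcd D) (lcd_class C)"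
  using assms
proof (induction "card (chords C - chords D)" arbitrary: C rule: less_induct)
  case less
  show ?case
  proof (cases "chords C \<subseteq> chords D")
    case True
    have "chords D \<subseteq> chords C"
    proof (rule subrelI)
      fix i j assume ij: "(i, j) \<in> chords D"
      hence "(i, j) \<in> und C" using less(2) by (simp add: und_def)
      hence "(i, j) \<in> chords C \<or> (j, i) \<in> chords D" using True by (auto simp: und_def)
      moreover have "(j, i) \<notin> chords D"
        using is_lcd_unique[OF is_lcd_chords ij, of "(j, i)" i] is_lcd_neq[OF is_lcd_chords ij] by auto
      ultimately show "(i, j) \<in> chords C" by simp
    qed
    hence "C = D" using True by (simp add: chords_inject flip: set_eq_subset)
    thus ?thesis by simp
  next
    case False
    then obtain i j where ij: "(i, j) \<in> chords C" "(i, j) \<notin> chords D" by auto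
    hence ji: "(j, i) \<in> chords D" using less(2) by (auto simp: und_def)
    obtain C' where C': "label_change C C'" "chords C' = insert (j, i) (chords C - {(i, j)})"
      using ex_label_change[OF ij(1)] by blast
    have "chords C' - chords D = (chords C - chords D) - {(i, j)}" using C'(2) ji by auto
    hence "card (chords C' - chords D) < card (chords C - chords D)"
      using ij finite_chords[of C] by (metis DiffI card_Diff1_less finite_Diff)
    moreover have "und C' = und D" using und_label_change[OF C'(1)] less(2) by simp
    ultimately have "lcd_class D = lscale (sgn_lcd C' * sgn_lcd D) (lcd_class C')" by (rule less(1))
    thus ?thesis
      using sgn_lcd_label_change[OF C'(1)] lcd_class_label_change[OF C'(1)] by simp
  qed
qed

lemma ex_root_chords:
  obtains c R where "chords C = insert c R" "c \<notin> R" "rooted c" "\<And>d. d \<in> R \<Longrightarrow> \<not> rooted d"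
  using ex_root[OF is_lcd_chords nchords_ge_1] by metis

text \<open>Rotation lowers every point other than 1 by one, which preserves order, while 1 turns
  from the least point into the greatest. So exactly the chord at 1 changes its orientation.\<close>

lemma sgn_lcd_rotate: "sgn_lcd (rotate C) = - sgn_lcd C"
proof -
  let ?m = "nchords C"
  let ?f = "map_prod (nu ?m) (nu ?m)"
  obtain c R where c: "chords C = insert c R" "c \<notin> R" "rooted c" "\<And>d. d \<in> R \<Longrightarrow> \<not> rooted d"
    using ex_root_chords[of C] by metis
  have rng: "fst d \<in> {1..2 * ?m}" "snd d \<in> {1..2 * ?m}" if "d \<in> chords C" for d
  proof -
    have "(fst d, snd d) \<in> und C" using that by (simp add: und_def)
    from und_range[OF this] show "fst d \<in> {1..2 * ?m}" "snd d \<in> {1..2 * ?m}" by simp_all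
  qed
  have neq: "fst d \<noteq> snd d" if "d \<in> chords C" for d
    using is_lcd_neq[OF is_lcd_chords that] .
  have inj: "inj_on ?f (chords C)"
  proof (intro inj_onI prod_eqI)
    fix d e assume de: "d \<in> chords C" "e \<in> chords C" "?f d = ?f e"
    hence "nu ?m (fst d) = nu ?m (fst e)" "nu ?m (snd d) = nu ?m (snd e)"
      by (metis fst_map_prod, metis snd_map_prod)
    thus "fst d = fst e" "snd d = snd e" using inj_onD[OF inj_on_nu] rng de(1,2) by blast+
  qed
  have R: "orient (?f d) = orient d" if "d \<in> R" for d
  proof -
    obtain i j where d: "d = (i, j)" by fastforce
    have "i \<noteq> 1" "j \<noteq> 1" "1 \<le> i" "1 \<le> j"
      using c(4)[OF that] rng[of d] c(1) that by (simp_all add: d rooted_def)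
    thus ?thesis by (auto simp: d orient_def nu_def)
  qed
  have "orient (?f c) = - orient c"
  proof -
    obtain i j where d: "c = (i, j)" by fastforce
    have "i = 1 \<or> j = 1" "i \<noteq> j" "1 \<le> i" "1 \<le> j" "i \<le> 2 * ?m" "j \<le> 2 * ?m"
      using c(3) rng[of c] neq[of c] c(1) by (simp_all add: d rooted_def)
    thus ?thesis by (auto simp: d orient_def nu_def)
  qed
  hence "(\<Prod>d\<in>chords C. orient (?f d)) = - (\<Prod>d\<in>chords C. orient d)"
    using c R finite_chords[of C] by simp
  thus ?thesis
    unfolding sgn_lcd_def chords_rotate by (simp add: prod.reindex[OF inj])
qed

section \<open>Amalgamation on signs and matchings\<close>

lemma chords_star:
  assumes "chords C = insert c R" "c \<notin> R" "rooted c"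
    and "chords D = insert d S" "d \<notin> S" "rooted d"
  shows "chords (star C D) = insert (join (nchords C) c d)
       ((\<lambda>(i, j). (i - 1, j - 1)) ` R
        \<union> (\<lambda>(a, b). (a + (2 * nchords C - 2), b + (2 * nchords C - 2))) ` S)"
  unfolding star.rep_eq by (rule star_chords_eq[OF is_lcd_chords assms(1-3) is_lcd_chords assms(4-6)])

text \<open>Both claims follow from the four cases of \<open>join\<close>. The second, that exactly
  one end lies below \<open>2 * m\<close>, separates the joined chord from all other chords of the
  amalgamation.\<close>

lemma join_ends:
  assumes "rooted (i, j)" "rooted (a, b)" "i \<noteq> j" "a \<noteq> b" "m \<ge> 1"
    and "1 \<le> i" "1 \<le> j" "i \<le> 2 * m" "j \<le> 2 * m" "1 \<le> a" "1 \<le> b"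
  shows "orient (join m (i, j) (a, b)) = - (orient (i, j) * orient (a, b))"
    and "fst (join m (i, j) (a, b)) < 2 * m \<longleftrightarrow> \<not> snd (join m (i, j) (a, b)) < 2 * m"
  using assms by (auto simp: rooted_def orient_def)

text \<open>Translating a chord keeps its orientation, so the minus sign comes from the joined chord
  alone.\<close>

lemma sgn_lcd_star: "sgn_lcd (star C D) = - (sgn_lcd C * sgn_lcd D)"
proof -
  let ?m = "nchords C"
  let ?f = "\<lambda>(i::nat, j::nat). (i - 1, j - 1)"
  let ?g = "\<lambda>(a, b). (a + (2 * ?m - 2), b + (2 * ?m - 2))"
  have m: "?m \<ge> 1" by (rule nchords_ge_1)
  obtain c R where c: "chords C = insert c R" "c \<notin> R" "rooted c" "\<And>d. d \<in> R \<Longrightarrow> \<not> rooted d"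
    using ex_root_chords[of C] by metis
  obtain d S where d: "chords D = insert d S" "d \<notin> S" "rooted d" "\<And>e. e \<in> S \<Longrightarrow> \<not> rooted e"
    using ex_root_chords[of D] by metis
  obtain i j where ij: "c = (i, j)" by fastforce
  obtain a b where ab: "d = (a, b)" by fastforce
  have "(i, j) \<in> und C" using c(1) ij by (simp add: und_def)
  note ij' = und_range[OF this] und_neq[OF this]
  have "(a, b) \<in> und D" using d(1) ab by (simp add: und_def)
  note ab' = und_range[OF this] und_neq[OF this]
  note J = join_ends[OF c(3)[unfolded ij] d(3)[unfolded ab] ij'(5) ab'(5) m ij'(1,3,2,4) ab'(1,3), folded ij ab]
  have R: "2 \<le> x \<and> x \<le> 2 * ?m \<and> 2 \<le> y \<and> y \<le> 2 * ?m" if "(x, y) \<in> R" for x y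
  proof -
    have "(x, y) \<in> und C" using that c(1) by (simp add: und_def)
    moreover have "x \<noteq> 1" "y \<noteq> 1" using c(4)[OF that] by (simp_all add: rooted_def)
    ultimately show ?thesis using und_range[of x y C] by fastforce
  qed
  have S: "2 \<le> x \<and> 2 \<le> y" if "(x, y) \<in> S" for x y
  proof -
    have "(x, y) \<in> und D" using that d(1) by (simp add: und_def)
    moreover have "x \<noteq> 1" "y \<noteq> 1" using d(4)[OF that] by (simp_all add: rooted_def)
    ultimately show ?thesis using und_range[of x y D] by fastforce
  qed
  have fR: "fst e < 2 * ?m \<and> snd e < 2 * ?m" if "e \<in> ?f ` R" for e
    using that R m by fastforce
  have gS: "2 * ?m \<le> fst e \<and> 2 * ?m \<le> snd e" if "e \<in> ?g ` S" for e
    using that S m by fastforce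
  have fin: "finite R" "finite S" using finite_chords[of C] finite_chords[of D] c(1) d(1) by simp_all
  \<comment> \<open>Chords from \<open>C\<close> lie below \<open>2 * ?m\<close>, those from
    \<open>D\<close> at or above it, and the joined chord crosses this bound; hence the product over
    the amalgamation splits without collisions.\<close>
  have disj: "?f ` R \<inter> ?g ` S = {}" using fR gS by (meson disjoint_iff not_less)
  have notin: "join ?m c d \<notin> ?f ` R \<union> ?g ` S" using fR gS J(2) by (meson UnE not_less)
  have "inj_on ?f R"
  proof (rule inj_onI)
    fix e e' assume "e \<in> R" "e' \<in> R" "?f e = ?f e'"
    thus "e = e'" using R[of "fst e" "snd e"] R[of "fst e'" "snd e'"]
      by (cases e; cases e') auto
  qed
  hence "(\<Prod>e\<in>?f ` R. orient e) = (\<Prod>e\<in>R. orient (?f e))" by (simp add: prod.reindex)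
  also have "\<dots> = (\<Prod>e\<in>R. orient e)"
  proof (rule prod.cong[OF refl])
    fix e assume "e \<in> R"
    thus "orient (?f e) = orient e" using R[of "fst e" "snd e"]
      by (cases e) (auto simp: orient_def)
  qed
  finally have 1: "(\<Prod>e\<in>?f ` R. orient e) = (\<Prod>e\<in>R. orient e)" .
  have "inj_on ?g S" by (rule inj_onI) auto
  hence "(\<Prod>e\<in>?g ` S. orient e) = (\<Prod>e\<in>S. orient (?g e))" by (simp add: prod.reindex)
  also have "\<dots> = (\<Prod>e\<in>S. orient e)"
    by (rule prod.cong[OF refl]) (auto simp: orient_def)
  finally have 2: "(\<Prod>e\<in>?g ` S. orient e) = (\<Prod>e\<in>S. orient e)" .
  have "sgn_lcd (star C D) = orient (join ?m c d) * (\<Prod>e\<in>?f ` R \<union> ?g ` S. orient e)"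
    by (rule sgn_lcd_insert[OF chords_star[OF c(1-3) d(1-3)] notin])
  also have "(\<Prod>e\<in>?f ` R \<union> ?g ` S. orient e) = (\<Prod>e\<in>R. orient e) * (\<Prod>e\<in>S. orient e)"
    using fin by (subst prod.union_disjoint[OF _ _ disj]) (simp_all only: 1 2 finite_imageI)
  finally show ?thesis
    by (simp add: J(1) sgn_lcd_insert[OF c(1,2)] sgn_lcd_insert[OF d(1,2)])
qed

lemma und_star_left:
  assumes "(i, j) \<in> und C" "i \<noteq> 1" "j \<noteq> 1"
  shows "(i - 1, j - 1) \<in> und (star C D)"
proof -
  obtain c R where c: "chords C = insert c R" "c \<notin> R" "rooted c"
    using ex_root_chords[of C] by metis
  obtain d S where d: "chords D = insert d S" "d \<notin> S" "rooted d"
    using ex_root_chords[of D] by metis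
  have "c \<noteq> (i, j)" "c \<noteq> (j, i)" using c(3) assms by (auto simp: rooted_def)
  hence "(i, j) \<in> R \<or> (j, i) \<in> R" using assms(1) c(1) by (auto simp: und_def)
  thus ?thesis unfolding und_def chords_star[OF c d] by force
qed

lemma und_star_right:
  assumes "(a, b) \<in> und D" "a \<noteq> 1" "b \<noteq> 1"
  shows "(a + (2 * nchords C - 2), b + (2 * nchords C - 2)) \<in> und (star C D)"
proof -
  obtain c R where c: "chords C = insert c R" "c \<notin> R" "rooted c"
    using ex_root_chords[of C] by metis
  obtain d S where d: "chords D = insert d S" "d \<notin> S" "rooted d"
    using ex_root_chords[of D] by metis
  have "d \<noteq> (a, b)" "d \<noteq> (b, a)" using d(3) assms by (auto simp: rooted_def)
  hence "(a, b) \<in> S \<or> (b, a) \<in> S" using assms(1) d(1) by (auto simp: und_def)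
  thus ?thesis unfolding und_def chords_star[OF c d] by force
qed

lemma und_star_join:
  assumes "(1, p) \<in> und C" "(1, q) \<in> und D"
  shows "(p - 1, q + (2 * nchords C - 2)) \<in> und (star C D)"
proof -
  obtain c R where c: "chords C = insert c R" "c \<notin> R" "rooted c" "\<And>d. d \<in> R \<Longrightarrow> \<not> rooted d"
    using ex_root_chords[of C] by metis
  obtain d S where d: "chords D = insert d S" "d \<notin> S" "rooted d" "\<And>d. d \<in> S \<Longrightarrow> \<not> rooted d"
    using ex_root_chords[of D] by metis
  have "(1, p) \<in> chords C \<or> (p, 1) \<in> chords C" "(1, q) \<in> chords D \<or> (q, 1) \<in> chords D"
    using assms by (auto simp: und_def)
  hence cd: "c = (1, p) \<or> c = (p, 1)" "d = (1, q) \<or> d = (q, 1)"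
    using c(1) d(1) c(4)[of "(1, p)"] c(4)[of "(p, 1)"] d(4)[of "(1, q)"] d(4)[of "(q, 1)"]
    by (auto simp: rooted_def)
  have "p \<noteq> 1" "q \<noteq> 1" using und_neq[OF assms(1)] und_neq[OF assms(2)] by auto
  hence "join (nchords C) c d = (p - 1, q + (2 * nchords C - 2))
       \<or> join (nchords C) c d = (q + (2 * nchords C - 2), p - 1)"
    using cd by auto
  thus ?thesis unfolding und_def chords_star[OF c(1-3) d(1-3)] by auto
qed

section \<open>Coefficients\<close>

text \<open>A label change keeps the matching and negates the sign, so the relations go to zero and
  the signed matching is well defined on classes. These coordinates make coefficients in the
  quotient readable.\<close>

lift_definition coeffs :: "lc \<Rightarrow> ((nat \<times> nat) set \<Rightarrow>\<^sub>0 rat)" is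
  "fextend (\<lambda>C. Poly_Mapping.single (und C) (sgn_lcd C))"
proof -
  let ?h = "\<lambda>C. Poly_Mapping.single (und C) (sgn_lcd C)"
  fix f g :: "lcd \<Rightarrow>\<^sub>0 rat"
  assume "f - g \<in> relations"
  hence "fextend ?h (f - g) = 0"
    unfolding relations_def
  proof (induction rule: free.span_induct_alt)
    case base
    show ?case by simp
  next
    case (step q x y)
    then obtain C C' where x: "x = Poly_Mapping.single C 1 + Poly_Mapping.single C' 1"
      and CC: "label_change C C'"
      by blast
    have "fextend ?h x = 0"
      unfolding x fextend_add fextend_single und_label_change[OF CC] sgn_lcd_label_change[OF CC]
      by (simp flip: single_add)
    thus ?case using step(2) by (simp add: fextend_add fextend_scale)
  qed
  thus "fextend ?h f = fextend ?h g" by (simp add: fextend_diff)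
qed

lemma coeffs_class: "coeffs (lcd_class C) = Poly_Mapping.single (und C) (sgn_lcd C)"
  by transfer simp

lemma coeffs_add: "coeffs (x + y) = coeffs x + coeffs y"
  by transfer (simp add: fextend_add)

lemma coeffs_scale: "coeffs (lscale q x) = fscale q (coeffs x)"
  by transfer (simp add: fextend_scale)

definition coef :: "(nat \<times> nat) set \<Rightarrow> lc \<Rightarrow> rat" where
  "coef U x = Poly_Mapping.lookup (coeffs x) U"

lemma coef_class: "coef U (lcd_class C) = (if und C = U then sgn_lcd C else 0)"
  by (simp add: coef_def coeffs_class lookup_single when_def)

lemma coef_add: "coef U (x + y) = coef U x + coef U y"
  by (simp add: coef_def coeffs_add lookup_add)

lemma coef_scale: "coef U (lscale q x) = q * coef U x"
  by (simp add: coef_def coeffs_scale)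

lemma coef_zero [simp]: "coef U 0 = 0"
  using coef_scale[of U 0 0] by simp

lemma coef_sum: "coef U (\<Sum>i\<in>A. f i) = (\<Sum>i\<in>A. coef U (f i))"
  by (induction A rule: infinite_finite_induct) (simp_all add: coef_add)

section \<open>Expansion along matchings\<close>

definition matchings :: "nat \<Rightarrow> (nat \<times> nat) set set" where
  "matchings m = und ` {C. nchords C = m}"

text \<open>Any diagram with the given matching; the choice affects the class only by a sign, for
  which \<open>sgn_lcd\<close> compensates in the expansion.\<close>

definition rep :: "(nat \<times> nat) set \<Rightarrow> lcd" where
  "rep U = (SOME C. und C = U)"

lemma finite_matchings: "finite (matchings m)"
proof (rule finite_subset)
  show "matchings m \<subseteq> Pow ({1..2*m} \<times> {1..2*m})"
    unfolding matchings_def using und_range by fastforce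
qed simp

lemma nchords_und_eq:
  assumes "und C = und D"
  shows "nchords C = nchords D"
proof -
  have *: "nchords C \<le> nchords D" if "und C = und D" for C D
  proof -
    obtain j where "(2 * nchords C, j) \<in> und C"
      using und_total[of "2 * nchords C" C] nchords_ge_1[of C] by auto
    thus ?thesis using und_range[of "2 * nchords C" j D] that by simp
  qed
  show ?thesis using *[of C D] *[of D C] assms by simp
qed

lemma und_rep: "U \<in> matchings m \<Longrightarrow> und (rep U) = U"
  unfolding matchings_def rep_def by (rule someI_ex) auto

lemma nchords_rep:
  assumes "U \<in> matchings m"
  shows "nchords (rep U) = m"
proof -
  obtain C where "U = und C" "nchords C = m" using assms by (auto simp: matchings_def)
  thus ?thesis using nchords_und_eq[of "rep U" C] und_rep[OF assms] by simp
qed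

text \<open>By linearity one class suffices. Its only nonzero coefficient sits at its own matching,
  and passing to the representative costs the product of the two signs.\<close>

lemma LC_expansion:
  assumes "x \<in> LC m"
  shows "x = (\<Sum>U\<in>matchings m. lscale (coef U x * sgn_lcd (rep U)) (lcd_class (rep U)))"
  using assms
proof (induction rule: LC_induct)
  case zero
  show ?case by simp
next
  case (step q C y)
  have U: "und C \<in> matchings m" using step(1) by (auto simp: matchings_def)
  have "(\<Sum>U\<in>matchings m. lscale (coef U (lcd_class C) * sgn_lcd (rep U)) (lcd_class (rep U)))
     = (\<Sum>U\<in>matchings m. if U = und C then
          lscale (sgn_lcd C * sgn_lcd (rep (und C))) (lcd_class (rep (und C))) else 0)"
    by (rule sum.cong) (auto simp: coef_class)
  also have "\<dots> = lscale (sgn_lcd C * sgn_lcd (rep (und C))) (lcd_class (rep (und C)))"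
    using U finite_matchings by simp
  also have "\<dots> = lcd_class C"
    using lcd_class_und_eq[OF und_rep[OF U]] by (simp add: mult.commute)
  finally have "lcd_class C
    = (\<Sum>U\<in>matchings m. lscale (coef U (lcd_class C) * sgn_lcd (rep U)) (lcd_class (rep U)))" ..
  with step(2) show ?case
    unfolding coef_add coef_scale lc.scale_left_distrib distrib_right sum.distrib
      mult.assoc lc.scale_scale[symmetric] lc.scale_sum_right[symmetric] by simp
qed

section \<open>The elements \<open>\<Omega>\<^sub>m\<close> are central\<close>

text \<open>Converse of \<open>und_star_left\<close>, \<open>und_star_right\<close> and
  \<open>und_star_join\<close>: once \<open>u\<close> is located, one of these produces a partner of
  \<open>u\<close>, and by uniqueness that partner is \<open>v\<close>.\<close>

lemma und_starE [consumes 1, case_names left right join join']: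
  assumes uv: "(u, v) \<in> und (star C D)"
  obtains (left) i j where "(i, j) \<in> und C" "i \<noteq> 1" "j \<noteq> 1" "u = i - 1" "v = j - 1"
  | (right) a b where "(a, b) \<in> und D" "a \<noteq> 1" "b \<noteq> 1"
      "u = a + (2 * nchords C - 2)" "v = b + (2 * nchords C - 2)"
  | (join) p q where "(1, p) \<in> und C" "(1, q) \<in> und D" "u = p - 1" "v = q + (2 * nchords C - 2)"
  | (join') p q where "(1, p) \<in> und C" "(1, q) \<in> und D" "v = p - 1" "u = q + (2 * nchords C - 2)"
proof -
  have m: "nchords C \<ge> 1" "nchords D \<ge> 1" by (rule nchords_ge_1)+
  note rng = und_range[OF uv, unfolded nchords_star]
  show ?thesis
  \<comment> \<open>Points below this bound are the points of \<open>C\<close> other than 1, lowered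
    by one; the remaining ones are the points of \<open>D\<close> other than 1, raised by
    \<open>2 * nchords C - 2\<close>.\<close>
  proof (cases "u < 2 * nchords C")
    case True
    then obtain j where j: "(u + 1, j) \<in> und C" using und_total[of "u + 1" C] by auto
    show ?thesis
    proof (cases "j = 1")
      case False
      have "v = j - 1"
        using und_unique[OF uv, of "j - 1"] und_star_left[OF j _ False, of D] rng by simp
      thus ?thesis using left[OF j _ False] rng by simp
    next
      case True
      hence p: "(1, u + 1) \<in> und C" using und_sym[OF j] by simp
      obtain q where q: "(1, q) \<in> und D" using und_total[of 1 D] m by auto
      have "v = q + (2 * nchords C - 2)"
        using und_unique[OF uv, of "q + (2 * nchords C - 2)"] und_star_join[OF p q] by simp
      thus ?thesis using join[OF p q] by simp
    qed
  next
    case False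
    define a where "a = u - (2 * nchords C - 2)"
    have a: "u = a + (2 * nchords C - 2)" "2 \<le> a" "a \<le> 2 * nchords D"
      using False rng m unfolding a_def by auto
    then obtain b where b: "(a, b) \<in> und D" using und_total[of a D] by auto
    show ?thesis
    proof (cases "b = 1")
      case False
      have "v = b + (2 * nchords C - 2)"
        using und_unique[OF uv] und_star_right[OF b _ False, of C] a by simp
      thus ?thesis using right[OF b _ False] a by simp
    next
      case True
      hence q: "(1, a) \<in> und D" using und_sym[OF b] by simp
      obtain p where p: "(1, p) \<in> und C" using und_total[of 1 C] m by auto
      have "v = p - 1"
        using und_unique[OF uv, of "p - 1"] und_sym[OF und_star_join[OF p q]] a by simp
      thus ?thesis using join'[OF p q] a by simp
    qed
  qed
qed

lemma und_rotateI: "(i, j) \<in> und C \<Longrightarrow> (nu (nchords C) i, nu (nchords C) j) \<in> und (rotate C)"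
  unfolding und_rotate by (rule map_prod_imageI)

lemma closing_lc_rotate:
  assumes "x \<in> LC m"
  shows "closing_lc m (rotate_lc x) = closing_lc m x"
proof -
  have "closing_lc m (rotate_lc x) = rotate_lc (closing_lc m x)"
    unfolding closing_lc_def rotate_lc_sum by (simp add: funpow_swap1)
  also have "(rotate_lc ^^ 1) (closing_lc m x) = closing_lc m x"
    using closing_lc_cyc[OF assms] unfolding cyc_def by blast
  hence "rotate_lc (closing_lc m x) = closing_lc m x" by simp
  finally show ?thesis .
qed

text \<open>The rotations alternate between two diagrams, each counted \<open>nchords C\<close>
  times. This serves both \<open>Omega_lcd\<close> and \<open>long_lcd\<close>.\<close>

lemma closing_two_periodic:
  assumes "rotate (rotate C) = C"
  shows "closing C = lscale (of_nat (nchords C)) (lcd_class C + lcd_class (rotate C))"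
proof -
  have even: "(rotate ^^ (2 * k)) C = C" for k
    by (induction k) (simp_all add: assms)
  have "(\<Sum>s<2 * k. lcd_class ((rotate ^^ s) C))
      = lscale (of_nat k) (lcd_class C + lcd_class (rotate C))" for k
    by (induction k) (simp_all add: even lc.scale_left_distrib add_ac)
  thus ?thesis by (simp add: closing_def)
qed

lemma nchords_Omega_lcd:
  assumes "m \<ge> 1"
  shows "nchords (Omega_lcd m) = m"
proof -
  have "chords (Omega_lcd m) = (\<lambda>k. (2*k - 1, 2*k)) ` {1..m}"
    using chords_Omega_lcd[OF assms] by (simp only: Setcompr_eq_image)
  thus ?thesis unfolding nchords_def by (simp add: card_image inj_on_def)
qed

lemma und_Omega_lcd:
  assumes "m \<ge> 1"
  shows "und (Omega_lcd m) = {(2*k - 1, 2*k) |k. k \<in> {1..m}} \<union> {(2*k, 2*k - 1) |k. k \<in> {1..m}}"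
  unfolding und_def chords_Omega_lcd[OF assms] by auto

lemma rotate_rotate_Omega_lcd:
  assumes m: "m \<ge> 1"
  shows "rotate (rotate (Omega_lcd m)) = Omega_lcd m"
proof (rule lcd_eqI)
  show "chords (rotate (rotate (Omega_lcd m))) \<subseteq> chords (Omega_lcd m)"
  proof
    fix c assume "c \<in> chords (rotate (rotate (Omega_lcd m)))"
    then obtain k where k: "k \<in> {1..m}" "c = (nu m (nu m (2*k - 1)), nu m (nu m (2*k)))"
      by (auto simp: chords_rotate nchords_Omega_lcd[OF m] chords_Omega_lcd[OF m])
    show "c \<in> chords (Omega_lcd m)"
    proof (cases "k = 1")
      case True
      hence "c = (2*m - 1, 2*m)" using k m by (simp add: nu_def)
      thus ?thesis using m by (auto simp: chords_Omega_lcd[OF m])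
    next
      case False
      hence "c = (2*(k - 1) - 1, 2*(k - 1))" "k - 1 \<in> {1..m}"
        using k by (auto simp: nu_def)
      thus ?thesis unfolding chords_Omega_lcd[OF m] by blast
    qed
  qed
qed simp

text \<open>On both sides the \<open>l - 1\<close> isolated chords occupy the first
  \<open>2 * l - 2\<close> points, followed by the points 2, 3, ..., \<open>2 * ?m\<close>, 1 of
  \<open>C\<close>. On the left the isolated chords sit between the points 1 and 2 of
  \<open>C\<close> before the rotation; on the right the root of \<open>rotate C\<close> is the
  point 2 of \<open>C\<close>.\<close>

lemma und_rotate_star_Omega:
  assumes l: "l \<ge> 1"
  shows "und (rotate (star (Omega_lcd l) C)) = und (star (rotate (Omega_lcd l)) (rotate C))"
proof (rule und_subset_eq)
  let ?A = "Omega_lcd l" and ?m = "nchords C"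
  let ?T = "star (rotate ?A) (rotate C)"
  let ?n = "l + ?m - 1"
  have m: "?m \<ge> 1" by (rule nchords_ge_1)
  have A [simp]: "nchords ?A = l" by (rule nchords_Omega_lcd[OF l])
  have root: "(1, 2 * l) \<in> und (rotate ?A)"
  proof -
    have "(2 * 1, 2 * 1 - 1) \<in> und ?A" unfolding und_Omega_lcd[OF l] using l by fastforce
    from und_rotateI[OF this] show ?thesis by (simp add: nu_def)
  qed
  \<comment> \<open>Here \<open>u\<close> and \<open>v\<close> are the positions of the points
    \<open>a\<close> and \<open>b\<close> of \<open>C\<close> in the left amalgamation; the point 1
    of \<open>C\<close> stays at 1. The value \<open>b = 2\<close> is set apart because 2 becomes
    the root after rotation.\<close>
  have other: "(nu ?n u, nu ?n v) \<in> und ?T"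
    if ab: "(a, b) \<in> und C" "b \<noteq> 2" "b \<noteq> 1"
      and u: "u = (if a = 1 then 1 else a + (2 * l - 2))" and v: "v = b + (2 * l - 2)" for a b u v
  proof -
    note rng = und_range[OF ab(1)]
    have rab: "(nu ?m a, nu ?m b) \<in> und (rotate C)" by (rule und_rotateI[OF ab(1)])
    have b: "nu ?m b = b - 1" "b - 1 \<noteq> 1" "nu ?n v = (b - 1) + (2 * l - 2)"
      using rng ab l by (auto simp: nu_def v)
    show ?thesis
    proof (cases "a = 2")
      case True
      have "(2 * l - 1, (b - 1) + (2 * l - 2)) \<in> und ?T"
        using und_star_join[OF root, of "b - 1" "rotate C"] rab b True by (simp add: nu_def)
      moreover have "nu ?n u = 2 * l - 1" using True l by (auto simp: nu_def u)
      ultimately show ?thesis using b by simp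
    next
      case False
      have "nu ?m a \<noteq> 1" using rng False by (auto simp: nu_def)
      hence "(nu ?m a + (2 * l - 2), (b - 1) + (2 * l - 2)) \<in> und ?T"
        using und_star_right[OF rab, of "rotate ?A"] b by simp
      moreover have "nu ?n u = nu ?m a + (2 * l - 2)"
        using False l m rng by (auto simp: nu_def u)
      ultimately show ?thesis using b by simp
    qed
  qed
  \<comment> \<open>The chord from 1 to 2 in \<open>C\<close> becomes the root chord of
    \<open>rotate C\<close>, so its image is the joined chord on the right.\<close>
  have two: "(nu ?n 1, nu ?n (2 + (2 * l - 2))) \<in> und ?T" if "(1, 2) \<in> und C"
  proof -
    have "(2 * ?m, 1) \<in> und (rotate C)" using und_rotateI[OF that] by (simp add: nu_def)
    from und_sym[OF und_star_join[OF root und_sym[OF this]]]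
    have "(2 * ?m + (2 * l - 2), 2 * l - 1) \<in> und ?T" by simp
    moreover have "nu ?n 1 = 2 * ?m + (2 * l - 2)" "nu ?n (2 + (2 * l - 2)) = 2 * l - 1"
      using l m by (auto simp: nu_def)
    ultimately show ?thesis by (simp only:)
  qed
  have gen: "(nu ?n u, nu ?n v) \<in> und ?T"
    if "(a, b) \<in> und C" "b \<noteq> 1"
      "u = (if a = 1 then 1 else a + (2 * l - 2))" "v = b + (2 * l - 2)" for a b u v
  proof (cases "b = 2")
    case False
    thus ?thesis using other[of a b u v] that by simp
  next
    case True
    show ?thesis
    proof (cases "a = 1")
      case True
      thus ?thesis using two that \<open>b = 2\<close> by simp
    next
      case False
      have "(nu ?n v, nu ?n u) \<in> und ?T"
        using other[of b a v u] und_sym[OF that(1)] und_neq[OF that(1)] that False True by auto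
      thus ?thesis by (rule und_sym)
    qed
  qed
  have omega: "(nu ?n (2*k - 1 - 1), nu ?n (2*k - 1)) \<in> und ?T" if "k \<in> {2..l}" for k
  proof -
    have "(2*k - 1, 2*k) \<in> und ?A" unfolding und_Omega_lcd[OF l] using that by fastforce
    from und_rotateI[OF this] have "(nu l (2*k - 1), nu l (2*k)) \<in> und (rotate ?A)" by simp
    moreover have "nu l (2*k - 1) = 2*k - 2" "nu l (2*k) = 2*k - 1"
      using that by (auto simp: nu_def)
    ultimately have "(2*k - 2, 2*k - 1) \<in> und (rotate ?A)" by (simp only:)
    from und_star_left[OF this, of "rotate C"] have "(2*k - 2 - 1, 2*k - 1 - 1) \<in> und ?T"
      using that by auto
    moreover have "2*k - 2 - 1 = 2*k - 3" "2*k - 1 - 1 = 2*k - 2" by simp_all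
    ultimately have "(2*k - 3, 2*k - 2) \<in> und ?T" by (simp only:)
    moreover have "nu ?n (2*k - 1 - 1) = 2*k - 3" "nu ?n (2*k - 1) = 2*k - 2"
      using that by (auto simp: nu_def)
    ultimately show ?thesis by simp
  qed
  show "und (rotate (star ?A C)) \<subseteq> und ?T"
  proof (rule subrelI)
    fix u' v' assume "(u', v') \<in> und (rotate (star ?A C))"
    then obtain u v where uv: "(u, v) \<in> und (star ?A C)" "u' = nu ?n u" "v' = nu ?n v"
      by (auto simp: und_rotate)
    have rt: "p = 2" if "(1, p) \<in> und ?A" for p
      using that unfolding und_Omega_lcd[OF l] by auto
    from uv(1) have "(nu ?n u, nu ?n v) \<in> und ?T"
    proof (cases rule: und_starE)
      case (left i j)
      from left(1) obtain k where k: "k \<in> {1..l}" "i = 2*k - 1 \<and> j = 2*k \<or> i = 2*k \<and> j = 2*k - 1"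
        unfolding und_Omega_lcd[OF l] by auto
      have "k \<in> {2..l}" using k left by (cases "k = 1") auto
      from omega[OF this] und_sym[OF omega[OF this]] k(2) show ?thesis using left by auto
    next
      case (right a b)
      thus ?thesis using gen[of a b u v] by simp
    next
      case (join p q)
      have "q \<noteq> 1" using und_neq[OF join(2)] by simp
      thus ?thesis using gen[of 1 q u v] join rt[OF join(1)] by simp
    next
      case (join' p q)
      have "q \<noteq> 1" using und_neq[OF join'(2)] by simp
      hence "(nu ?n v, nu ?n u) \<in> und ?T" using gen[of 1 q v u] join' rt[OF join'(1)] by simp
      thus ?thesis by (rule und_sym)
    qed
    thus "(u', v') \<in> und ?T" using uv by simp
  qed
qed simp

text \<open>Rotating both factors contributes two signs, which cancel, whereas rotating the
  amalgamation contributes one; the closing itself is insensitive to that rotation.\<close>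

lemma closing_lc_star_Omega:
  assumes l: "l \<ge> 1" and x: "x \<in> LC m"
  shows "closing_lc (l + m - 1) (star_lc (lcd_class (rotate (Omega_lcd l))) (rotate_lc x))
    = - closing_lc (l + m - 1) (star_lc (lcd_class (Omega_lcd l)) x)"
  using x
proof (induction rule: LC_induct)
  case zero
  show ?case by simp
next
  case (step q C y)
  let ?A = "Omega_lcd l"
  have LC: "lcd_class (star ?A C) \<in> LC (l + m - 1)"
    using LC_class[of "star ?A C"] step(1) nchords_Omega_lcd[OF l] by simp
  have "lcd_class (star (rotate ?A) (rotate C))
     = lscale (sgn_lcd (rotate (star ?A C)) * sgn_lcd (star (rotate ?A) (rotate C)))
        (lcd_class (rotate (star ?A C)))"
    by (rule lcd_class_und_eq[OF und_rotate_star_Omega[OF l]])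
  also have "sgn_lcd (rotate (star ?A C)) * sgn_lcd (star (rotate ?A) (rotate C))
     = - ((sgn_lcd ?A * sgn_lcd ?A) * (sgn_lcd C * sgn_lcd C))"
    unfolding sgn_lcd_rotate sgn_lcd_star by (simp only: minus_minus mult_minus_left mult_minus_right mult_ac)
  finally have "lcd_class (star (rotate ?A) (rotate C)) = - rotate_lc (lcd_class (star ?A C))"
    by (simp add: lc.scale_minus_left)
  hence "lcd_class (star (rotate ?A) (rotate C))
      = lscale (- 1) (rotate_lc (lcd_class (star ?A C)))" by simp
  hence "closing_lc (l + m - 1) (lcd_class (star (rotate ?A) (rotate C)))
     = - closing_lc (l + m - 1) (lcd_class (star ?A C))"
    by (simp only: closing_lc_scale closing_lc_rotate[OF LC]) simp
  thus ?case using step(2)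
    by (simp add: rotate_lc_add rotate_lc_scale star_lc_add_right star_lc_scale_right
        closing_lc_add closing_lc_scale)
qed

lemma bracket_Omega:
  assumes "l \<ge> 1" "x \<in> cyc m"
  shows "bracket l m (Omega l) x = 0"
proof -
  have x: "x \<in> LC m" "(rotate_lc ^^ 1) x = x" using assms(2) unfolding cyc_def by blast+
  \<comment> \<open>With \<open>x\<close> fixed by rotation, the two diagrams that make up
    \<open>Omega l\<close> give opposite closings.\<close>
  have "closing_lc (l + m - 1) (star_lc (lcd_class (rotate (Omega_lcd l))) x)
      = - closing_lc (l + m - 1) (star_lc (lcd_class (Omega_lcd l)) x)"
    using closing_lc_star_Omega[OF assms(1) x(1)] x(2) by simp
  thus ?thesis
    by (simp add: bracket_def Omega_def
        closing_two_periodic[OF rotate_rotate_Omega_lcd[OF assms(1)]]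
        star_lc_scale_left star_lc_add_left closing_lc_scale closing_lc_add)
qed

section \<open>Rigidity of amalgamations with a long diagram\<close>

text \<open>On both sides the points below \<open>2 * ?m\<close> belong to the first factor and the
  others to the second. Chords inside a block return the non-root chords of its factor, and the one
  chord between the blocks returns the partners of both roots.\<close>

lemma und_star_inj:
  assumes eq: "und (star C D) = und (star C' D')"
    and n: "nchords C = nchords C'" "nchords D = nchords D'"
  shows "und C = und C'" "und D = und D'"
proof -
  let ?m = "nchords C"
  have m: "?m \<ge> 1" "nchords D \<ge> 1" by (rule nchords_ge_1)+
  have high: "2 * ?m \<le> a + (2 * nchords C' - 2)" if "(a, v) \<in> und D'" "a \<noteq> 1" for a v
    using und_range[OF that(1)] that(2) n m by simp
  obtain p0 where p0: "(1, p0) \<in> und C" using und_total[of 1 C] m by auto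
  obtain q0 where q0: "(1, q0) \<in> und D" using und_total[of 1 D] m by auto
  have C1: "(1, p) \<in> und C'" if p: "(1, p) \<in> und C" for p
  proof -
    have q: "2 \<le> q0" "2 \<le> p" "p \<le> 2 * ?m"
      using und_range[OF q0] und_neq[OF q0] und_range[OF p] und_neq[OF p] by auto
    have "(p - 1, q0 + (2 * ?m - 2)) \<in> und (star C' D')"
      using und_star_join[OF p q0] eq by simp
    thus ?thesis
    proof (cases rule: und_starE)
      case (left i j)
      thus ?thesis using und_range[OF left(1)] q n m by simp
    next
      case (right a b)
      thus ?thesis using high[OF right(1,2)] q m by simp
    next
      case (join p' q')
      hence "p = p'" using q und_range[OF join(1)] by simp
      thus ?thesis using join by simp
    next
      case (join' p' q')
      thus ?thesis using und_range[OF join'(1)] q n m by simp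
    qed
  qed
  have D1: "(1, q) \<in> und D'" if q: "(1, q) \<in> und D" for q
  proof -
    have r: "2 \<le> q" "2 \<le> p0" "p0 \<le> 2 * ?m"
      using und_range[OF q] und_neq[OF q] und_range[OF p0] und_neq[OF p0] by auto
    have "(p0 - 1, q + (2 * ?m - 2)) \<in> und (star C' D')"
      using und_star_join[OF p0 q] eq by simp
    thus ?thesis
    proof (cases rule: und_starE)
      case (left i j)
      thus ?thesis using und_range[OF left(1)] r n m by simp
    next
      case (right a b)
      thus ?thesis using high[OF right(1,2)] r m by simp
    next
      case (join p' q')
      hence "q = q'" using n by simp
      thus ?thesis using join by simp
    next
      case (join' p' q')
      thus ?thesis using und_range[OF join'(1)] r n m by simp
    qed
  qed
  show "und C = und C'"
  proof (rule und_subset_eq[OF subrelI n(1)])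
    fix i j assume ij: "(i, j) \<in> und C"
    note rng = und_range[OF ij]
    consider "i = 1" | "j = 1" | "i \<noteq> 1" "j \<noteq> 1" by blast
    thus "(i, j) \<in> und C'"
    proof cases
      case 1 thus ?thesis using C1 ij by simp
    next
      case 2 thus ?thesis using und_sym[OF C1[of i]] und_sym[OF ij] by simp
    next
      case 3
      have "(i - 1, j - 1) \<in> und (star C' D')" using und_star_left[OF ij 3, of D] eq by simp
      thus ?thesis
      proof (cases rule: und_starE)
        case (left i' j')
        hence "i = i'" "j = j'" using rng 3 und_range[OF left(1)] by auto
        thus ?thesis using left by simp
      next
        case (right a b)
        thus ?thesis using high[OF right(1,2)] rng m by simp
      next
        case (join p q)
        thus ?thesis using und_range[OF join(2)] und_neq[OF join(2)] rng n m by simp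
      next
        case (join' p q)
        thus ?thesis using und_range[OF join'(2)] und_neq[OF join'(2)] rng n m by simp
      qed
    qed
  qed
  show "und D = und D'"
  proof (rule und_subset_eq[OF subrelI n(2)])
    fix i j assume ij: "(i, j) \<in> und D"
    note rng = und_range[OF ij]
    consider "i = 1" | "j = 1" | "i \<noteq> 1" "j \<noteq> 1" by blast
    thus "(i, j) \<in> und D'"
    proof cases
      case 1 thus ?thesis using D1 ij by simp
    next
      case 2 thus ?thesis using und_sym[OF D1[of i]] und_sym[OF ij] by simp
    next
      case 3
      have "(i + (2 * ?m - 2), j + (2 * ?m - 2)) \<in> und (star C' D')"
        using und_star_right[OF ij 3] eq by metis
      thus ?thesis
      proof (cases rule: und_starE)
        case (left i' j')
        thus ?thesis using und_range[OF left(1)] rng 3 n m by simp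
      next
        case (right a b)
        hence "i = a" "j = b" using n by auto
        thus ?thesis using right by simp
      next
        case (join p q)
        thus ?thesis using und_range[OF join(1)] rng 3 n m by simp
      next
        case (join' p q)
        thus ?thesis using und_range[OF join'(1)] rng 3 n m by simp
      qed
    qed
  qed
qed

text \<open>For nonzero \<open>r\<close> the block of \<open>C\<close> would be carried to an arc in
  a new position that only one chord leaves, but the long chords of \<open>D\<close> force a second
  one. The shape conditions concern only \<open>C0\<close> and \<open>D\<close>, so the lemma
  compares one chosen amalgamation with every other term of a bracket.\<close>

lemma star_rotation_rigid:
  assumes m: "nchords C0 = m" "nchords C = m" "m \<ge> 2"
    and l: "nchords D = l" "nchords D' = l"
    and root: "(1, 2) \<notin> und C0" "(1, 2 * m) \<notin> und C0"
    and long: "\<And>i j. (i, j) \<in> und D \<Longrightarrow> i < j \<Longrightarrow> 2 * m < j - i \<and> j - i + 2 * m < 2 * l"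
    and r: "r < 2 * (m + l - 1)"
    and eq: "und ((rotate ^^ r) (star C D')) = und (star C0 D)"
  shows "r = 0"
proof (rule ccontr)
  assume "r \<noteq> 0"
  define n where "n = m + l - 1"
  let ?S = "und (star C0 D)"
  \<comment> \<open>The block of \<open>C\<close> after rotation, to be viewed inside
    \<open>?S\<close> through the assumed equality.\<close>
  define I where "I = (nu n ^^ r) ` {1..2 * m - 1}"
  have l1: "l \<ge> 1" using nchords_ge_1[of D] l by simp
  have n: "2 * n = 2 * m + 2 * l - 2" "r < 2 * n" using r l1 m by (auto simp: n_def)
  obtain p where p: "(1, p) \<in> und C0" using und_total[of 1 C0] m by auto
  \<comment> \<open>Since the root chord of \<open>C0\<close> does not join neighbours,
    \<open>a\<close> below is not an end of the block \<open>{1..2 * m - 1}\<close>; it therefore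
    stays in \<open>I\<close> when \<open>I\<close> is this block shifted by one step.\<close>
  have p': "3 \<le> p" "p \<le> 2 * m - 1"
  proof -
    have "p \<noteq> 1" "p \<noteq> 2" "p \<noteq> 2 * m" using und_neq[OF p] p root by auto
    thus "3 \<le> p" "p \<le> 2 * m - 1" using und_range[OF p] m by auto
  qed
  obtain q where q: "(1, q) \<in> und D" using und_total[of 1 D] l l1 by auto
  have q': "2 * m < q - 1" "q - 1 + 2 * m < 2 * l"
    using long[OF q] und_range[OF q] und_neq[OF q] by auto
  define a where "a = p - 1"
  define b where "b = q + (2 * m - 2)"
  have ab: "(a, b) \<in> ?S" using und_star_join[OF p q] m by (simp add: a_def b_def)
  have bounds: "2 \<le> a" "a \<le> 2 * m - 2" "4 * m \<le> b" "b + 2 * m \<le> 2 * n"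
    using p' q' m n by (auto simp: a_def b_def)
  \<comment> \<open>Apart from \<open>b\<close>, every point from \<open>D\<close> is joined to a
    point from \<open>D\<close> at distance more than \<open>2 * m\<close>, farther than an arc of
    \<open>2 * m - 1\<close> points reaches.\<close>
  have far: "e = b \<and> f = a \<or> (2 * m \<le> f \<and> (e + 2 * m < f \<or> f + 2 * m < e))"
    if ef: "(e, f) \<in> ?S" and e: "2 * m \<le> e" for e f
    using ef
  proof (cases rule: und_starE)
    case (left i j)
    thus ?thesis using und_range[OF left(1)] e m by simp
  next
    case (right i j)
    hence "1 < j" using und_range[OF right(1)] by simp
    moreover have "i < j \<or> j < i" using und_neq[OF right(1)] by auto
    ultimately show ?thesis using long[OF right(1)] long[OF und_sym[OF right(1)]] right m by auto
  next
    case (join p' q')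
    thus ?thesis using und_range[OF join(1)] e m by simp
  next
    case (join' p' q')
    thus ?thesis using und_unique[OF p join'(1)] und_unique[OF q join'(2)] m
      by (simp add: a_def b_def)
  qed
  have uniq: "i = p - 1" if pp: "(1, p) \<in> und C" and iu: "(i, u) \<in> und (star C D')" "i < 2 * m" "2 * m \<le> u"
    for i u p
    using iu(1)
  proof (cases rule: und_starE)
    case (left i j)
    thus ?thesis using und_range[OF left(1)] iu m by simp
  next
    case (right i j)
    thus ?thesis using und_range[OF right(1)] iu m by simp
  next
    case (join p' q')
    thus ?thesis using und_unique[OF pp join(1)] by simp
  next
    case (join' p' q')
    thus ?thesis using und_range[OF join'(1)] iu m by simp
  qed
  have nu_eq: "(nu n ^^ r) i = (if r < i then i - r else i + 2 * n - r)" if "1 \<le> i" "i \<le> 2 * n" for i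
    by (rule nu_funpow_explicit) (use that n in auto)
  \<comment> \<open>The point \<open>x\<close> is the image of \<open>x + r\<close> modulo
    \<open>2 * n\<close>; the second alternative is the one with a reduction.\<close>
  have mem: "x \<in> I \<longleftrightarrow> x + r \<le> 2 * m - 1 \<or> 2 * n < x + r \<and> x + r \<le> 2 * n + 2 * m - 1"
    if x: "1 \<le> x" "x \<le> 2 * n" for x
  proof
    assume "x \<in> I"
    then obtain i where i: "1 \<le> i" "i \<le> 2 * m - 1" "x = (nu n ^^ r) i" by (auto simp: I_def)
    thus "x + r \<le> 2 * m - 1 \<or> 2 * n < x + r \<and> x + r \<le> 2 * n + 2 * m - 1"
      using nu_eq[of i] n l1 by (auto split: if_splits)
  next
    assume *: "x + r \<le> 2 * m - 1 \<or> 2 * n < x + r \<and> x + r \<le> 2 * n + 2 * m - 1"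
    define i where "i = (if 2 * n < x + r then x + r - 2 * n else x + r)"
    have "1 \<le> i" "i \<le> 2 * m - 1" "i \<le> 2 * n" using * x n l1 by (auto simp: i_def)
    moreover have "i \<le> r \<and> x = i + 2 * n - r \<or> r < i \<and> x = i - r"
      using x by (auto simp: i_def)
    hence "(nu n ^^ r) i = x" using nu_eq[of i] calculation by auto
    ultimately show "x \<in> I" unfolding I_def by force
  qed
  have nch: "nchords (star C D') = n" using m l by (simp add: n_def)
  obtain p1 where p1: "(1, p1) \<in> und C" using und_total[of 1 C] m by auto
  \<comment> \<open>By \<open>uniq\<close> a single point of the block of \<open>C\<close> has its
    partner outside the block, so a single point of \<open>I\<close> has its partner outside
    \<open>I\<close>. Each case below exhibits two.\<close>
  have out: "e = (nu n ^^ r) (p1 - 1)" if e: "e \<in> I" "(e, f) \<in> ?S" "f \<notin> I" for e f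
  proof -
    obtain i where i: "1 \<le> i" "i \<le> 2 * m - 1" "e = (nu n ^^ r) i" using e(1) by (auto simp: I_def)
    obtain i' u where iu: "(i', u) \<in> und (star C D')" "e = (nu n ^^ r) i'" "f = (nu n ^^ r) u"
      using e(2) unfolding eq[symmetric] und_rotate_funpow nch by auto
    note rng = und_range[OF iu(1), unfolded nch]
    have "i' = i"
      using i iu(2) nu_eq[of i] nu_eq[of i'] rng n l1 by (auto split: if_splits)
    moreover have "2 * m \<le> u"
    proof (rule ccontr)
      assume "\<not> 2 * m \<le> u"
      hence "u \<in> {1..2 * m - 1}" using rng by simp
      thus False using e(3) iu(3) unfolding I_def by blast
    qed
    ultimately have "i' = p1 - 1" using uniq[OF p1 iu(1)] i by simp
    thus ?thesis using iu(2) by simp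
  qed
  have contra: False
    if "e \<in> I" "(e, f) \<in> ?S" "f \<notin> I" "e' \<in> I" "(e', f') \<in> ?S" "f' \<notin> I" "e \<noteq> e'" for e f e' f'
    using out[OF that(1-3)] out[OF that(4-6)] that(7) by simp
  have S_rng: "1 \<le> e" "e \<le> 2 * n" if "(e, f) \<in> ?S" for e f
    using und_range[OF that] m l by (auto simp: n_def)
  have S_tot: "\<exists>f. (e, f) \<in> ?S" if "1 \<le> e" "e \<le> 2 * n" for e
    using und_total[of e "star C0 D"] that m l by (auto simp: n_def)
  \<comment> \<open>By \<open>near\<close>, a long chord starting at \<open>e\<close> overshoots
    \<open>I\<close>; the only other partner possible is \<open>a\<close>, reached from
    \<open>b\<close>.\<close>
  have leave: "\<exists>f. (e, f) \<in> ?S \<and> f \<notin> I"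
    if e: "2 * m \<le> e" "e \<le> 2 * n"
      and near: "\<And>f. f \<in> I \<Longrightarrow> 2 * m \<le> f \<Longrightarrow> f \<le> 2 * n \<Longrightarrow> f \<le> e + 2 * m \<and> e \<le> f + 2 * m"
      and b: "e = b \<Longrightarrow> a \<notin> I" for e
  proof -
    obtain f where f: "(e, f) \<in> ?S" using S_tot[of e] e m by auto
    have "1 \<le> f" "f \<le> 2 * n" using S_rng[OF und_sym[OF f]] by auto
    hence "f \<notin> I" using far[OF f e(1)] near[of f] b by fastforce
    thus ?thesis using f by blast
  qed
  have rng_ab: "1 \<le> a" "a \<le> 2 * n" "1 \<le> b" "b \<le> 2 * n" using bounds m by auto
  \<comment> \<open>The arc has moved back by \<open>r\<close>. For \<open>r = 1\<close> and
    \<open>r = 2 * n - 1\<close> it meets the block of \<open>D\<close> only in \<open>2 * n\<close>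
    and \<open>2 * m\<close> respectively, and \<open>a\<close> supplies the second exit. Otherwise
    it contains two adjacent points from \<open>D\<close>, and both are exits.\<close>
  consider "r = 1" | "2 \<le> r" "r < 2 * m - 1" | "2 * m - 1 \<le> r" "r \<le> 2 * n - 2" | "r = 2 * n - 1"
    using \<open>r \<noteq> 0\<close> n by linarith
  thus False
  proof cases
    case 1
    have "\<exists>f. (2 * n, f) \<in> ?S \<and> f \<notin> I"
      by (rule leave) (use bounds m(3) n(2) 1 mem in auto)
    moreover have "2 * n \<in> I" using mem[of "2 * n"] m(3) bounds 1 by auto
    moreover have "a \<in> I" using mem[OF rng_ab(1,2)] bounds m(3) 1 by auto
    moreover have "b \<notin> I" using mem[OF rng_ab(3,4)] bounds m(3) 1 by auto
    moreover have "2 * n \<noteq> a" using bounds m(3) by auto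
    ultimately show False using contra ab by blast
  next
    case 2
    have "\<exists>f. (2 * n, f) \<in> ?S \<and> f \<notin> I"
      by (rule leave) (use bounds m(3) n(2) 2 mem in auto)
    moreover have "\<exists>f. (2 * n - 1, f) \<in> ?S \<and> f \<notin> I"
      by (rule leave) (use bounds m(3) n(2) 2 mem in auto)
    moreover have "2 * n \<in> I" "2 * n - 1 \<in> I"
      using mem[of "2 * n"] mem[of "2 * n - 1"] m(3) bounds 2 by auto
    moreover have "2 * n \<noteq> 2 * n - 1" using bounds by auto
    ultimately show False using contra by blast
  next
    case 3
    \<comment> \<open>The last point of the arc, which does not wrap around here. If it reaches
      \<open>b\<close>, it misses \<open>a\<close>, because \<open>b\<close> and \<open>a\<close>
      are more than \<open>2 * m\<close> apart.\<close>
    define t where "t = 2 * n + 2 * m - 1 - r"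
    have t: "t + r = 2 * n + 2 * m - 1" "2 * m + 1 \<le> t" "t \<le> 2 * n"
      using 3 m(3) n(2) by (auto simp: t_def)
    have a: "a \<notin> I" if "e = b" "e \<le> t" for e
      using mem[OF rng_ab(1,2)] bounds that t 3 by auto
    have "\<exists>f. (t, f) \<in> ?S \<and> f \<notin> I"
      by (rule leave) (use bounds m(3) n(2) 3 t mem a in auto)
    moreover have "\<exists>f. (t - 1, f) \<in> ?S \<and> f \<notin> I"
      by (rule leave) (use bounds m(3) n(2) 3 t mem a in auto)
    moreover have "t \<in> I" "t - 1 \<in> I"
      using mem[of t] mem[of "t - 1"] m(3) 3 t by auto
    moreover have "t \<noteq> t - 1" using t by auto
    ultimately show False using contra by blast
  next
    case 4
    have "\<exists>f. (2 * m, f) \<in> ?S \<and> f \<notin> I"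
      by (rule leave) (use bounds m(3) n(2) 4 mem in auto)
    moreover have "2 * m \<in> I" using mem[of "2 * m"] bounds m(3) 4 by auto
    moreover have "a \<in> I" using mem[OF rng_ab(1,2)] bounds m(3) 4 by auto
    moreover have "b \<notin> I" using mem[OF rng_ab(3,4)] bounds m(3) 4 by auto
    moreover have "2 * m \<noteq> a" using bounds m(3) by auto
    ultimately show False using contra ab by blast
  qed
qed

section \<open>A long diagram\<close>

text \<open>
  The chords join every odd \<open>i\<close> to \<open>i + (2m+1)\<close> modulo \<open>4m+4\<close>.  This is invariant under rotation by
  two steps but not by one, since \<open>2m+1\<close> and \<open>-(2m+1)\<close> differ modulo \<open>4m+4\<close>; so its closing is
  not zero.
\<close>

definition long_chord :: "nat \<Rightarrow> nat \<Rightarrow> nat \<times> nat" where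
  "long_chord m k = (2 * k + 1, if k \<le> m + 1 then 2 * k + 2 * m + 2 else 2 * k - (2 * m + 2))"

definition long_lcd :: "nat \<Rightarrow> lcd" where
  "long_lcd m = Abs_lcd (long_chord m ` {..<2 * m + 2})"

lemma is_lcd_long: "is_lcd (2 * m + 2) (long_chord m ` {..<2 * m + 2})"
proof (rule is_lcd_I)
  let ?O = "long_chord m ` {..<2 * m + 2}"
  show "card ?O \<le> 2 * m + 2" using card_image_le[of "{..<2 * m + 2}" "long_chord m"] by simp
  show "fst ` ?O \<union> snd ` ?O = {1..2 * (2 * m + 2)}"
  proof
    show "fst ` ?O \<union> snd ` ?O \<subseteq> {1..2 * (2 * m + 2)}" by (auto simp: long_chord_def)
    show "{1..2 * (2 * m + 2)} \<subseteq> fst ` ?O \<union> snd ` ?O"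
    proof
      fix x assume x: "x \<in> {1..2 * (2 * m + 2)}"
      show "x \<in> fst ` ?O \<union> snd ` ?O"
      proof (cases "even x")
        case True
        then obtain y where y: "x = 2 * y" by (rule evenE)
        \<comment> \<open>Solves \<open>snd (long_chord m k) = 2 * y\<close>: the shift by
          \<open>m + 1\<close> modulo \<open>2 * m + 2\<close> is undone.\<close>
        define k where "k = (if y \<le> m then y + m + 1 else y - (m + 1))"
        have "x = snd (long_chord m k)" "k < 2 * m + 2"
          using x y by (auto simp: k_def long_chord_def)
        thus ?thesis by blast
      next
        case False
        then obtain k where "x = 2 * k + 1" by (rule oddE)
        hence "x = fst (long_chord m k)" "k < 2 * m + 2" using x by (auto simp: long_chord_def)
        thus ?thesis by blast
      qed
    qed
  qed
qed simp

lemma chords_long_lcd: "chords (long_lcd m) = long_chord m ` {..<2 * m + 2}"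
  unfolding long_lcd_def using is_lcd_long[of m] by (subst Abs_lcd_inverse) auto

lemma nchords_long_lcd: "nchords (long_lcd m) = 2 * m + 2"
  using is_lcd_long[of m] by (intro nchords_eqI) (simp only: chords_long_lcd)

lemma rotate_rotate_long_lcd: "rotate (rotate (long_lcd m)) = long_lcd m"
proof (rule lcd_eqI)
  let ?nu = "nu (2 * m + 2)"
  show "chords (rotate (rotate (long_lcd m))) \<subseteq> chords (long_lcd m)"
  proof
    fix c assume "c \<in> chords (rotate (rotate (long_lcd m)))"
    hence "c \<in> (\<lambda>k. map_prod ?nu ?nu (map_prod ?nu ?nu (long_chord m k))) ` {..<2 * m + 2}"
      by (simp only: chords_rotate nchords_rotate nchords_long_lcd chords_long_lcd image_image)
    then obtain k where k: "k < 2 * m + 2"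
      "c = map_prod ?nu ?nu (map_prod ?nu ?nu (long_chord m k))" by blast
    show "c \<in> chords (long_lcd m)"
    proof (cases "k = 0")
      case True
      hence "c = long_chord m (2 * m + 1)" using k by (auto simp: long_chord_def nu_def)
      thus ?thesis unfolding chords_long_lcd by simp
    next
      case False
      hence "c = long_chord m (k - 1)" "k - 1 < 2 * m + 2"
        using k by (auto simp: long_chord_def nu_def)
      thus ?thesis unfolding chords_long_lcd by blast
    qed
  qed
qed simp

text \<open>The two ends differ by \<open>2 * m + 1\<close> or \<open>2 * m + 3\<close>. This is the
  length condition of \<open>star_rotation_rigid\<close> for \<open>2 * m + 2\<close>
  chords.\<close>

lemma und_long_lcd_distance:
  assumes "(i, j) \<in> und (long_lcd m)" "i < j"
  shows "2 * m < j - i \<and> j - i + 2 * m < 2 * (2 * m + 2)"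
  using assms unfolding und_def chords_long_lcd
  by (auto simp: long_chord_def split: if_splits)

text \<open>The partner of 1 is \<open>2 * m + 2\<close> in the diagram and \<open>2 * m + 4\<close>
  in its rotation. Hence the two terms of the closing, whose signs are opposite, cannot
  cancel.\<close>

lemma und_rotate_long_lcd_neq: "und (rotate (long_lcd m)) \<noteq> und (long_lcd m)"
proof
  let ?D = "long_lcd m"
  assume eq: "und (rotate ?D) = und ?D"
  have k: "long_chord m k \<in> und ?D" if "k < 2 * m + 2" for k
    unfolding und_def chords_long_lcd using that by blast
  have 1: "(1, 2 * m + 2) \<in> und ?D"
    using k[of 0] by (simp add: long_chord_def)
  show False
  proof (cases "m = 0")
    \<comment> \<open>The index \<open>m + 2\<close> used in the other case is out of range for
      \<open>m = 0\<close>.\<close>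
    case True
    have "(1, 4) \<in> und ?D"
      using und_sym[OF und_rotateI[OF 1]] eq by (simp add: nu_def nchords_long_lcd True)
    thus False using und_unique[OF 1, of 4] True by simp
  next
    case False
    have "long_chord m (m + 2) = (2 * m + 5, 2)" by (simp add: long_chord_def)
    hence "(2 * m + 5, 2) \<in> und ?D" using k[of "m + 2"] False by simp
    from und_sym[OF und_rotateI[OF this]]
    have "(nu (2 * m + 2) 2, nu (2 * m + 2) (2 * m + 5)) \<in> und ?D"
      by (simp only: eq nchords_long_lcd)
    moreover have "nu (2 * m + 2) 2 = 1" "nu (2 * m + 2) (2 * m + 5) = 2 * m + 4"
      by (auto simp: nu_def)
    ultimately have "(1, 2 * m + 4) \<in> und ?D" by (simp only:)
    thus False using und_unique[OF 1, of "2 * m + 4"] by simp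
  qed
qed

section \<open>Coefficient extraction\<close>

lemma coef_closing:
  "coef E (closing F) = (\<Sum>r<2 * nchords F. if und ((rotate ^^ r) F) = E then sgn_lcd ((rotate ^^ r) F) else 0)"
  by (simp add: closing_def coef_sum coef_class)

lemma rotate_lc_funpow_sum: "(rotate_lc ^^ s) (\<Sum>i\<in>A. f i) = (\<Sum>i\<in>A. (rotate_lc ^^ s) (f i))"
  by (induction A rule: infinite_finite_induct) (simp_all add: rotate_lc_funpow_add)

text \<open>The coefficient of the bracket at one suitable matching \<open>E\<close> receives a
  contribution from a single term: the one with matching \<open>U\<close>, the unrotated long
  diagram and no rotation of the amalgamation.\<close>

lemma coef_eq_0_if_not_isolated:
  assumes m: "m \<ge> 2" and x: "x \<in> cyc m"
    and bracket: "bracket m (2 * m + 2) x (closing (long_lcd m)) = 0"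
    and U: "U \<in> matchings m" and pq: "(p, q) \<in> U" "q \<noteq> nu m p" "p \<noteq> nu m q"
  shows "coef U x = 0"
proof -
  \<comment> \<open>This rotation brings \<open>p\<close> to the root 1. Invariance of
    \<open>x\<close> permits applying it to all terms of the expansion at once.\<close>
  define s where "s = p - 1"
  define l where "l = 2 * m + 2"
  let ?D = "long_lcd m"
  let ?c = "\<lambda>V. (rotate ^^ s) (rep V)"
  define k where "k V = coef V x * sgn_lcd (rep V)" for V
  define E where "E = und (star (?c U) ?D)"
  have nc: "nchords (?c V) = m" if "V \<in> matchings m" for V
    using nchords_rep[OF that] by simp
  have D: "nchords ?D = l" "nchords (rotate ?D) = l" by (simp_all add: nchords_long_lcd l_def)
  have "(p, q) \<in> und (rep U)" using pq(1) und_rep[OF U] by simp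
  note rng = und_range[OF this, unfolded nchords_rep[OF U]] and neq = und_neq[OF this]
  have "map_prod (nu m ^^ s) (nu m ^^ s) (p, q) \<in> und (?c U)"
    unfolding und_rotate_funpow nchords_rep[OF U] und_rep[OF U] using pq(1) by (rule imageI)
  moreover have "(nu m ^^ s) p = 1" using rng by (simp add: nu_funpow_explicit s_def)
  moreover define j where "j = (nu m ^^ s) q"
  ultimately have j: "(1, j) \<in> und (?c U)" by simp
  \<comment> \<open>The conditions on \<open>p\<close> and \<open>q\<close> say that they are not
    cyclic neighbours; after rotation, the partner of the root is neither 2 nor
    \<open>2 * m\<close>.\<close>
  have "j \<noteq> 2 \<and> j \<noteq> 2 * m"
    using nu_funpow_explicit[of q m s] rng neq pq(2,3)
    by (auto simp: j_def s_def nu_def split: if_splits)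
  hence root: "(1, 2) \<notin> und (?c U)" "(1, 2 * m) \<notin> und (?c U)"
    using und_unique[OF j] by blast+
  have rigid: "r = 0 \<and> und (?c V) = und (?c U) \<and> und D' = und ?D"
    if V: "V \<in> matchings m" and D': "nchords D' = l" and r: "r < 2 * (m + l - 1)"
      and eq: "und ((rotate ^^ r) (star (?c V) D')) = E" for V D' r
  proof -
    have "r = 0"
      using star_rotation_rigid[OF nc[OF U] nc[OF V] m D(1) D' root _ r] eq
        und_long_lcd_distance by (simp only: E_def l_def)
    hence "und (star (?c V) D') = und (star (?c U) ?D)" using eq by (simp add: E_def)
    from und_star_inj[OF this] \<open>r = 0\<close> show ?thesis using nc[OF U] nc[OF V] D D' by simp
  qed
  have zero: "coef E (closing (star (?c V) D')) = 0"
    if V: "V \<in> matchings m" and D': "nchords D' = l" and ne: "V \<noteq> U \<or> und D' \<noteq> und ?D" for V D'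
  proof -
    have "und (?c V) \<noteq> und (?c U)" if "V \<noteq> U"
      using und_rotate_funpow_inj[of s "rep V" "rep U"] that und_rep[OF U] und_rep[OF V]
        nchords_rep[OF U] nchords_rep[OF V] by auto
    hence "und ((rotate ^^ r) (star (?c V) D')) \<noteq> E" if "r < 2 * (m + l - 1)" for r
      using rigid[OF V D' that] ne by blast
    thus ?thesis unfolding coef_closing nchords_star nc[OF V] D' by (intro sum.neutral) simp
  qed
  \<comment> \<open>By rigidity no nontrivial rotation returns to \<open>E\<close>, so nothing
    cancels within this closing.\<close>
  have one: "coef E (closing (star (?c U) ?D)) \<noteq> 0"
  proof -
    have "coef E (closing (star (?c U) ?D))
       = (\<Sum>r<2 * (m + l - 1). if r = 0 then sgn_lcd (star (?c U) ?D) else 0)"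
      unfolding coef_closing nchords_star nc[OF U] D(1)
    proof (rule sum.cong[OF refl])
      fix r assume "r \<in> {..<2 * (m + l - 1)}"
      hence "und ((rotate ^^ r) (star (?c U) ?D)) = E \<longleftrightarrow> r = 0"
        using rigid[OF U D(1), of r] by (auto simp: E_def)
      thus "(if und ((rotate ^^ r) (star (?c U) ?D)) = E then sgn_lcd ((rotate ^^ r) (star (?c U) ?D)) else 0)
         = (if r = 0 then sgn_lcd (star (?c U) ?D) else 0)" by auto
    qed
    thus ?thesis using m by simp
  qed
  have "x \<in> LC m" "(rotate_lc ^^ s) x = x" using x unfolding cyc_def by blast+
  hence "x = (rotate_lc ^^ s) (\<Sum>V\<in>matchings m. lscale (k V) (lcd_class (rep V)))"
    using LC_expansion[of x m] by (simp add: k_def)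
  hence x_eq: "x = (\<Sum>V\<in>matchings m. lscale (k V) (lcd_class (?c V)))"
    by (simp add: rotate_lc_funpow_sum rotate_lc_funpow_scale)
  have cl: "closing_lc (m + l - 1) (lcd_class (star (?c V) D')) = closing (star (?c V) D')"
    if "V \<in> matchings m" "nchords D' = l" for V D'
    by (rule closing_lc_class) (simp only: nchords_star nc[OF that(1)] that(2))
  have "0 = coef E (bracket m l x (closing ?D))" using bracket by (simp add: l_def)
  \<comment> \<open>The closing of the long diagram is \<open>l\<close> times the sum of its two
    rotations, hence the factor and the two summands.\<close>
  also have "\<dots> = of_nat l * (\<Sum>V\<in>matchings m. k V *
      (coef E (closing (star (?c V) ?D)) + coef E (closing (star (?c V) (rotate ?D)))))"
    unfolding bracket_def closing_two_periodic[OF rotate_rotate_long_lcd] D(1)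
      star_lc_scale_right star_lc_add_right closing_lc_scale closing_lc_add
    by (subst (1 2) x_eq) (simp add: star_lc_sum_left star_lc_scale_left closing_lc_sum closing_lc_scale
        cl D coef_sum coef_add coef_scale distrib_left sum.distrib del: One_nat_def cong: sum.cong)
  also have "(\<Sum>V\<in>matchings m. k V *
      (coef E (closing (star (?c V) ?D)) + coef E (closing (star (?c V) (rotate ?D)))))
    = (\<Sum>V\<in>matchings m. if V = U then k U * coef E (closing (star (?c U) ?D)) else 0)"
    using zero D und_rotate_long_lcd_neq[of m] by (intro sum.cong) auto
  also have "\<dots> = k U * coef E (closing (star (?c U) ?D))" using U finite_matchings by simp
  finally have "k U = 0" using one by (simp add: l_def)
  thus ?thesis by (simp add: k_def)
qed

section \<open>Diagrams with isolated chords only\<close>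

text \<open>Going upwards from the chord at 1 and 2, each next odd point finds its predecessor taken
  and must be joined to its successor.\<close>

lemma isolated_und_eq_Omega:
  assumes m: "nchords C = m" and 1: "(1, 2) \<in> und C"
    and iso: "\<And>p q. (p, q) \<in> und C \<Longrightarrow> q = nu m p \<or> p = nu m q"
  shows "und C = und (Omega_lcd m)"
proof -
  have m1: "m \<ge> 1" using nchords_ge_1[of C] m by simp
  have step: "(2 * k + 1, 2 * k + 2) \<in> und C" if "k < m" for k
    using that
  proof (induction k)
    case 0
    show ?case using 1 by (simp add: numeral_2_eq_2)
  next
    case (Suc k)
    have prev: "(2 * k + 2, 2 * k + 1) \<in> und C" by (rule und_sym, rule Suc.IH) (use Suc.prems in simp)
    obtain q where q: "(2 * k + 3, q) \<in> und C" using und_total[of "2 * k + 3" C] Suc.prems m by auto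
    have "q \<noteq> 2 * k + 2" using und_unique[OF prev, of "2 * k + 3"] und_sym[OF q] by auto
    moreover have "q = 2 * k + 2 \<or> 2 * k + 3 = nu m q" using iso[OF q] by (auto simp: nu_def)
    ultimately have "2 * k + 3 = nu m q" by simp
    \<comment> \<open>Parity excludes the wrap-around value of \<open>nu\<close>.\<close>
    moreover have "2 * k + 3 \<noteq> 2 * m" by presburger
    ultimately have "q = 2 * k + 4" by (simp add: nu_def split: if_splits)
    moreover have "2 * Suc k + 1 = 2 * k + 3" "2 * Suc k + 2 = 2 * k + 4" by simp_all
    ultimately show ?case using q by (simp only:)
  qed
  have "und (Omega_lcd m) \<subseteq> und C"
  proof (rule subrelI)
    fix i j assume "(i, j) \<in> und (Omega_lcd m)"
    then obtain k where k: "k \<in> {1..m}" "(i, j) = (2*k - 1, 2*k) \<or> (i, j) = (2*k, 2*k - 1)"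
      unfolding und_Omega_lcd[OF m1] by auto
    have "(2*k - 1, 2*k) \<in> und C"
    proof -
      have "2 * (k - 1) + 1 = 2*k - 1" "2 * (k - 1) + 2 = 2*k" using k(1) by auto
      moreover have "k - 1 < m" using k(1) by auto
      ultimately show ?thesis using step[of "k - 1"] by (simp only:)
    qed
    thus "(i, j) \<in> und C" using k(2) und_sym by auto
  qed
  from und_subset_eq[OF this] show ?thesis using nchords_Omega_lcd[OF m1] m by simp
qed

text \<open>If 1 and 2 are not joined, then 2 is joined to 3, and one rotation leads back to the
  previous situation.\<close>

lemma isolated_und_cases:
  assumes m: "nchords C = m" "m \<ge> 2"
    and iso: "\<And>p q. (p, q) \<in> und C \<Longrightarrow> q = nu m p \<or> p = nu m q"
  shows "und C = und (Omega_lcd m) \<or> und C = und (rotate (Omega_lcd m))"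
proof (cases "(1, 2) \<in> und C")
  case True
  thus ?thesis using isolated_und_eq_Omega[OF m(1) _ iso] by blast
next
  case False
  have m1: "m \<ge> 1" using m by simp
  obtain q where q: "(2, q) \<in> und C" using und_total[of 2 C] m by auto
  have "q \<noteq> 1" using False und_sym[OF q] by auto
  hence "q = 3" using iso[OF q] und_range[OF q] m by (auto simp: nu_def split: if_splits)
  hence 1: "(1, 2) \<in> und (rotate C)" using und_rotateI[OF q] by (simp add: nu_def)
  have "q = nu m p \<or> p = nu m q" if pq: "(p, q) \<in> und (rotate C)" for p q
  proof -
    obtain i j where "(i, j) \<in> und C" "p = nu m i" "q = nu m j"
      using pq unfolding und_rotate m by auto
    thus ?thesis using iso by blast
  qed
  hence "und (rotate C) = und (Omega_lcd m)"
    using isolated_und_eq_Omega[of "rotate C" m] 1 m by simp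
  hence "und (rotate C) = und (rotate (rotate (Omega_lcd m)))"
    by (simp only: rotate_rotate_Omega_lcd[OF m1])
  thus ?thesis using und_rotate_inj[of C "rotate (Omega_lcd m)"] m nchords_Omega_lcd[OF m1] by simp
qed

text \<open>Only the two alternating diagrams remain in the expansion of \<open>x\<close>. Both have
  closing \<open>Omega m\<close>, while closing the invariant \<open>x\<close> multiplies it by
  \<open>2 * m\<close>, so dividing exhibits \<open>x\<close> as a multiple of
  \<open>Omega m\<close>.\<close>

lemma central_imp_multiple_Omega:
  assumes m: "m \<ge> 2" and x: "x \<in> cyc m"
    and bracket: "bracket m (2 * m + 2) x (closing (long_lcd m)) = 0"
  obtains q where "x = lscale q (Omega m)"
proof -
  let ?A = "Omega_lcd m"
  let ?B = "rotate ?A"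
  have m1: "m \<ge> 1" using m by simp
  have nA: "nchords ?A = m" by (rule nchords_Omega_lcd[OF m1])
  have xLC: "x \<in> LC m" using x by (simp add: cyc_def)
  have summand: "lscale (coef U x * sgn_lcd (rep U)) (lcd_class (rep U)) \<in> lc.span {lcd_class ?A, lcd_class ?B}"
    if U: "U \<in> matchings m" for U
  proof (cases "coef U x = 0")
    case True
    thus ?thesis by (simp add: lc.span_zero)
  next
    case False
    have "q = nu m p \<or> p = nu m q" if "(p, q) \<in> und (rep U)" for p q
      using coef_eq_0_if_not_isolated[OF m x bracket U, of p q] that False und_rep[OF U] by auto
    hence "und (rep U) = und ?A \<or> und (rep U) = und ?B"
      by (rule isolated_und_cases[OF nchords_rep[OF U] m])
    hence "lcd_class (rep U) \<in> lc.span {lcd_class ?A, lcd_class ?B}"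
    proof
      assume "und (rep U) = und ?A"
      from lcd_class_und_eq[OF this[symmetric]] show ?thesis
        by (simp add: lc.span_scale lc.span_base)
    next
      assume "und (rep U) = und ?B"
      from lcd_class_und_eq[OF this[symmetric]] show ?thesis
        by (simp add: lc.span_scale lc.span_base)
    qed
    thus ?thesis by (rule lc.span_scale)
  qed
  have "x \<in> lc.span {lcd_class ?A, lcd_class ?B}"
    by (subst LC_expansion[OF xLC]) (rule lc.span_sum, rule summand)
  then obtain a b where ab: "x = lscale a (lcd_class ?A) + lscale b (lcd_class ?B)"
    unfolding lc.span_insert lc.span_singleton by (auto simp: algebra_simps)
  have cA: "closing_lc m (lcd_class ?A) = Omega m"
    using closing_lc_class[OF nA] by (simp add: Omega_def)
  have cB: "closing_lc m (lcd_class ?B) = Omega m"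
    using closing_lc_rotate[OF LC_class, of ?A] nA cA by simp
  have "closing_lc m x = lscale (a + b) (Omega m)"
    unfolding ab by (simp add: closing_lc_add closing_lc_scale cA cB lc.scale_left_distrib)
  moreover have "closing_lc m x = lscale (of_nat (2 * m)) x"
  proof -
    have const: "(\<Sum>s<n. x) = lscale (of_nat n) x" for n
      by (induction n) (simp_all add: lc.scale_left_distrib add.commute)
    have "closing_lc m x = (\<Sum>s<2 * m. x)" using x unfolding closing_lc_def cyc_def by simp
    thus ?thesis by (simp only: const)
  qed
  ultimately have "lscale (inverse (of_nat (2 * m))) (lscale (of_nat (2 * m)) x)
      = lscale (inverse (of_nat (2 * m))) (lscale (a + b) (Omega m))" by simp
  hence "x = lscale (inverse (of_nat (2 * m)) * (a + b)) (Omega m)" using m1 by simp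
  thus ?thesis by (rule that)
qed

section \<open>The two inclusions for the center\<close>

theorem theorem3p2p7:
  shows "lie_center = graded_product (\<lambda>m. {lscale q (Omega m) |q. True})"
proof
  show "lie_center \<subseteq> graded_product (\<lambda>m. {lscale q (Omega m) |q. True})"
  proof
    fix z assume z: "z \<in> lie_center"
    hence zc: "z \<in> chord_algebra" by (simp add: lie_center_def)
    have "\<exists>q. z m = lscale q (Omega m)" if m: "m \<ge> 2" for m
    proof -
      let ?l = "2 * m + 2"
      define y where "y = closing (long_lcd m)"
      \<comment> \<open>A test element concentrated in one degree: in degree
        \<open>m + ?l - 1\<close> of the bracket, the second index \<open>?l\<close> determines the
        first, so only the component \<open>z m\<close> is tested.\<close>
      define w where "w n = (if n = ?l then y else 0)" for n
      have zm: "z m \<in> cyc m" using zc m by (simp add: chord_algebra_def graded_product_def)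
      have "y \<in> cyc ?l" using closing_mem_cyc[of "long_lcd m"] by (simp add: y_def nchords_long_lcd)
      hence "w \<in> chord_algebra"
        using lc.subspace_0[OF subspace_cyc] by (simp add: chord_algebra_def graded_product_def w_def)
      hence "lie_bracket z w (m + ?l - 1) = 0" using z unfolding lie_center_def by auto
      moreover have "lie_bracket z w (m + ?l - 1)
        = (\<Sum>p\<in>{(m', l). 2 \<le> m' \<and> 2 \<le> l \<and> m' + l - 1 = m + ?l - 1}.
             if p = (m, ?l) then bracket m ?l (z m) y else 0)"
        unfolding lie_bracket_def
      proof (rule sum.cong[OF refl])
        fix p assume "p \<in> {(m', l). 2 \<le> m' \<and> 2 \<le> l \<and> m' + l - 1 = m + ?l - 1}"
        then obtain m' l where p: "p = (m', l)" "2 \<le> m'" "2 \<le> l" "m' + l - 1 = m + ?l - 1" by auto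
        have "bracket m' l (z m') 0 = 0" by (simp add: bracket_def)
        thus "(case p of (m', l) \<Rightarrow> bracket m' l (z m') (w l))
            = (if p = (m, ?l) then bracket m ?l (z m) y else 0)"
          using p by (auto simp: w_def)
      qed
      moreover have "\<dots> = bracket m ?l (z m) y"
        using finite_bracket_index m by (subst sum.delta) auto
      ultimately have "bracket m ?l (z m) y = 0" by simp
      from central_imp_multiple_Omega[OF m zm this[unfolded y_def]] show ?thesis by blast
    qed
    thus "z \<in> graded_product (\<lambda>m. {lscale q (Omega m) |q. True})"
      using zc by (auto simp: graded_product_def chord_algebra_def)
  qed
  show "graded_product (\<lambda>m. {lscale q (Omega m) |q. True}) \<subseteq> lie_center"
  proof
    fix z assume "z \<in> graded_product (\<lambda>m. {lscale q (Omega m) |q. True})"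
    hence z0: "\<And>m. m < 2 \<Longrightarrow> z m = 0"
      and zq: "\<And>m. m \<ge> 2 \<Longrightarrow> \<exists>q. z m = lscale q (Omega m)"
      by (auto simp: graded_product_def)
    have "z m \<in> cyc m" if m: "m \<ge> 2" for m
    proof -
      have "Omega m \<in> cyc m"
        using closing_mem_cyc[of "Omega_lcd m"] m nchords_Omega_lcd[of m] by (simp add: Omega_def)
      thus ?thesis using zq[OF m] lc.subspace_scale[OF subspace_cyc] by auto
    qed
    hence "z \<in> chord_algebra" using z0 by (simp add: chord_algebra_def graded_product_def)
    moreover have "lie_bracket z w = (\<lambda>_. 0)" if w: "w \<in> chord_algebra" for w
    proof
      fix n
      have "bracket m l (z m) (w l) = 0" if "2 \<le> m" "2 \<le> l" for m l
      proof -
        have "w l \<in> cyc l" using w that by (simp add: chord_algebra_def graded_product_def)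
        hence "bracket m l (Omega m) (w l) = 0" using bracket_Omega that by simp
        thus ?thesis using zq[OF that(1)] by (auto simp: bracket_scale_left)
      qed
      thus "lie_bracket z w n = 0" unfolding lie_bracket_def by (intro sum.neutral) auto
    qed
    ultimately show "z \<in> lie_center" by (simp add: lie_center_def)
  qed
qed

end
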